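(* Let $n\geq 2$, $M\geq 3$ and $0\leq y\leq n$ be integers. Then $(n-y,y)\in\mathrm{HWP}(C_M[n];M,Mn)$, except possibly when at least one of the following holds: (1) $y=1$ and it is not the case that ($n=2$ and $M$ is odd); (2) $y=2<n$, $n\equiv 2\pmod 4$ and $M$ is odd; (3) $(y,n)\in\{(0,2),(0,6)\}$ and $M$ is odd.
   Context: $C_M[n]$ denotes the lexicographic product of the $M$-cycle with the empty graph on $n$ vertices: vertex set $\mathbb Z_M\times\mathbb Z_n$, with $(i,x)(j,y)$ an edge iff $j-i\equiv\pm1\pmod M$. A $C_k$-factor of a graph $G$ is a spanning subgraph of $G$ all of whose components are cycles of length $k$. For a graph $G$ and integers $M,N\ge3$, $\mathrm{HWP}(G;M,N)$ is the set of pairs $(\alpha,\beta)$ of nonnegative integers such that $G$ admits a set of $\alpha$ $C_M$-factors and $\beta$ $C_N$-factors whose edge sets partition $E(G)$. *)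

theory Defs
  imports Main
begin

(* Simple graphs are given by a vertex set V and an edge set E of 2-element sets. *)

definition cycle_edges :: "'a list \<Rightarrow> 'a set set" where
  "cycle_edges vs = {{vs ! i, vs ! (Suc i mod length vs)} | i. i < length vs}"

definition is_k_cycle :: "nat \<Rightarrow> 'a list \<Rightarrow> bool" where
  "is_k_cycle k vs \<longleftrightarrow> k \<ge> 3 \<and> length vs = k \<and> distinct vs"

definition is_Ck_factor :: "'a set \<Rightarrow> 'a set set \<Rightarrow> nat \<Rightarrow> 'a set set \<Rightarrow> bool" where
  "is_Ck_factor V E k F \<longleftrightarrow> F \<subseteq> E \<and>
     (\<exists>Cs :: 'a list set.
        (\<forall>vs\<in>Cs. is_k_cycle k vs) \<and>
        (\<forall>vs\<in>Cs. \<forall>ws\<in>Cs. vs \<noteq> ws \<longrightarrow> set vs \<inter> set ws = {}) \<and>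
        (\<Union>vs\<in>Cs. set vs) = V \<and>
        F = (\<Union>vs\<in>Cs. cycle_edges vs))"

definition HWP :: "'a set \<Rightarrow> 'a set set \<Rightarrow> nat \<Rightarrow> nat \<Rightarrow> (nat \<times> nat) set" where
  "HWP V E M N = {(\<alpha>, \<beta>). \<exists>f :: nat \<Rightarrow> 'a set set.
      (\<forall>i<\<alpha>. is_Ck_factor V E M (f i)) \<and>
      (\<forall>i. \<alpha> \<le> i \<and> i < \<alpha> + \<beta> \<longrightarrow> is_Ck_factor V E N (f i)) \<and>
      (\<forall>i<\<alpha> + \<beta>. \<forall>j<\<alpha> + \<beta>. i \<noteq> j \<longrightarrow> f i \<inter> f j = {}) \<and>
      (\<Union>i<\<alpha> + \<beta>. f i) = E}"

definition lexC_verts :: "nat \<Rightarrow> nat \<Rightarrow> (nat \<times> nat) set" where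
  "lexC_verts M n = {0..<M} \<times> {0..<n}"

definition lexC_edges :: "nat \<Rightarrow> nat \<Rightarrow> (nat \<times> nat) set set" where
  "lexC_edges M n = {{(i, x), (j, y)} | i x j y.
      i < M \<and> x < n \<and> j < M \<and> y < n \<and>
      (j = (i + 1) mod M \<or> i = (j + 1) mod M)}"

end

theory Submission
  imports Defs "HOL-Number_Theory.Cong"
begin

text \<open>
  Identify every layer of $C_M[n]$ with $\mathbb Z_n$. A row of shifts $s_0,\dots,s_{M-1}$, one for each pair
  of consecutive layers, gives a 2-factor: a $C_M$-factor if the shifts add up to $0$, a Hamilton cycle if
  the sum is a unit modulo $n$. A matrix with $n$ rows whose columns are permutations of $\mathbb Z_n$
  therefore decomposes $C_M[n]$, and two further columns $v, -v$ raise $M$ by two, so that matrices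
  with two, three or four columns suffice. Transposing neighbouring entries of a column in two rows of sum
  $0$ turns both of them into Hamilton cycles.

  If $n$ is even, the total of a matrix fixes the parity of the number of rows with unit sum. The other
  parity is reached by redistributing the edges of two suitable rows around layer $1$, where both rows
  become Hamilton cycles that turn back at two vertices of this layer.

  For $y = 0$, $M$ odd and $n$ even no such matrix exists. A transversal design with four groups of size $n$
  (a pair of orthogonal Latin squares) does the job instead; these exist for $n \notin \{2, 6\}$ by cyclic
  quasi-difference matrices (orders 4, 8, 10, 14), direct products, and Wilson's construction for $3t + u$.
\<close>

section \<open>Transversal designs\<close>

text \<open>The case distinctions come from the total of a matrix. For even n each column sums to
  n/2 modulo n, so the total is M*n/2; for odd n it is 0. If n is even, units are odd, so the number
  of unit rows has the parity of M*n/2. With y = 1 the only nonzero row would carry the whole total,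
  which is 0 or n/2, and n/2 is a unit only for n = 2; this is the origin of exception (1). The two
  rows of a twisted pair sum to 0 and -1, so only one of them is odd, yet both become Hamilton
  cycles: this changes the parity. If y = 2, such a pair makes the total -1; for odd M and odd n/2
  this would have to equal n/2, so again n = 2, whence exception (2). If y = 0, M is odd and n is
  even, the total n/2 is not 0, so not all rows can have sum 0. Exception (3) consists of the orders
  without a pair of orthogonal Latin squares.\<close>

definition transversal_design :: "nat \<Rightarrow> 'a set \<Rightarrow> (nat \<Rightarrow> 'a) set \<Rightarrow> bool" where
  "transversal_design k X S \<longleftrightarrow>
     (\<forall>b\<in>S. \<forall>i<k. b i \<in> X) \<and>
     (\<forall>i<k. \<forall>j<k. i \<noteq> j \<longrightarrow> (\<forall>p\<in>X. \<forall>q\<in>X. \<exists>b\<in>S. b i = p \<and> b j = q)) \<and>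
     (\<forall>b\<in>S. \<forall>c\<in>S. \<forall>i<k. \<forall>j<k. i \<noteq> j \<longrightarrow> b i = c i \<longrightarrow> b j = c j \<longrightarrow> (\<forall>l<k. b l = c l))"

lemma transversal_designI:
  assumes "\<And>b i. b \<in> S \<Longrightarrow> i < k \<Longrightarrow> b i \<in> X"
    and "\<And>i j p q. i < k \<Longrightarrow> j < k \<Longrightarrow> i \<noteq> j \<Longrightarrow> p \<in> X \<Longrightarrow> q \<in> X \<Longrightarrow> \<exists>b\<in>S. b i = p \<and> b j = q"
    and "\<And>b c i j l. b \<in> S \<Longrightarrow> c \<in> S \<Longrightarrow> i < k \<Longrightarrow> j < k \<Longrightarrow> i \<noteq> j \<Longrightarrow> b i = c i \<Longrightarrow> b j = c j \<Longrightarrow> l < k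
      \<Longrightarrow> b l = c l"
  shows "transversal_design k X S"
  unfolding transversal_design_def
  by (intro conjI ballI allI impI; (rule assms(1) | rule assms(2) | rule assms(3)); assumption)

lemma transversal_designD:
  assumes "transversal_design k X S"
  shows "b \<in> S \<Longrightarrow> i < k \<Longrightarrow> b i \<in> X"
    and "i < k \<Longrightarrow> j < k \<Longrightarrow> i \<noteq> j \<Longrightarrow> p \<in> X \<Longrightarrow> q \<in> X \<Longrightarrow> \<exists>b\<in>S. b i = p \<and> b j = q"
    and "b \<in> S \<Longrightarrow> c \<in> S \<Longrightarrow> i < k \<Longrightarrow> j < k \<Longrightarrow> i \<noteq> j \<Longrightarrow> b i = c i \<Longrightarrow> b j = c j \<Longrightarrow> l < k
      \<Longrightarrow> b l = c l"
  using assms unfolding transversal_design_def by (simp, metis, metis)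

text \<open>For fixed \<open>i\<close> and \<open>j\<close> the map from \<open>b\<close> to
  \<open>(b i, b j)\<close> is onto \<open>X \<times> X\<close>, and the bound on
  \<open>card S\<close> leaves no room for two blocks with the same image. Existence alone then
  makes a design.\<close>

lemma transversal_design_by_card:
  assumes "finite S" "card S \<le> card X * card X"
    and cl: "\<And>b i. b \<in> S \<Longrightarrow> i < k \<Longrightarrow> b i \<in> X"
    and ex: "\<And>i j p q. i < k \<Longrightarrow> j < k \<Longrightarrow> i \<noteq> j \<Longrightarrow> p \<in> X \<Longrightarrow> q \<in> X \<Longrightarrow> \<exists>b\<in>S. b i = p \<and> b j = q"
  shows "transversal_design k X S"
proof (rule transversal_designI, fact cl, fact ex)
  fix b c i j l
  assume bc: "b \<in> S" "c \<in> S" "i < k" "j < k" "i \<noteq> j" "b i = c i" "b j = c j" "l < k"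
  define f where "f = (\<lambda>b. (b i :: 'a, b j))"
  have "X \<times> X \<subseteq> f ` S"
    using ex[OF bc(3-5)] by (fastforce simp: f_def)
  then have im: "f ` S = X \<times> X"
    using cl bc by (auto simp: f_def)
  have "card (f ` S) = card S"
    using assms(1,2) im by (metis card_cartesian_product card_image_le le_antisym)
  then have "inj_on f S"
    using assms(1) by (simp add: eq_card_imp_inj_on)
  then show "b l = c l"
    using bc by (auto simp: f_def inj_on_def)
qed

lemma transversal_design_transfer:
  assumes "transversal_design k X S" "bij_betw \<phi> X Y"
  shows "transversal_design k Y ((\<lambda>b i. \<phi> (b i)) ` S)"
proof (rule transversal_designI)
  fix i j p q assume ij: "i < k" "j < k" "i \<noteq> j" and pq: "p \<in> Y" "q \<in> Y"
  then obtain p' q' where "p' \<in> X" "q' \<in> X" "p = \<phi> p'" "q = \<phi> q'"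
    using assms(2) by (auto simp: bij_betw_def)
  moreover from this obtain b where "b \<in> S" "b i = p'" "b j = q'"
    using transversal_designD(2)[OF assms(1) ij] by metis
  ultimately show "\<exists>b\<in>(\<lambda>b i. \<phi> (b i)) ` S. b i = p \<and> b j = q"
    by (intro bexI[OF _ imageI[of b]]) simp_all
next
  fix b c i j l
  assume *: "b \<in> (\<lambda>b i. \<phi> (b i)) ` S" "c \<in> (\<lambda>b i. \<phi> (b i)) ` S" "i < k" "j < k" "i \<noteq> j"
    "b i = c i" "b j = c j" "l < k"
  obtain b' c' where bc: "b' \<in> S" "c' \<in> S" "b = (\<lambda>i. \<phi> (b' i))" "c = (\<lambda>i. \<phi> (c' i))"
    using *(1,2) by (elim imageE)
  have "b' i \<in> X" "c' i \<in> X" "b' j \<in> X" "c' j \<in> X"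
    using transversal_designD(1)[OF assms(1)] bc(1,2) *(3,4) by simp_all
  then have "b' i = c' i" "b' j = c' j"
    using *(6,7) bc(3,4) assms(2) by (simp_all add: bij_betw_def inj_on_def)
  then show "b l = c l"
    using transversal_designD(3)[OF assms(1) bc(1,2) *(3-5)] *(8) bc(3,4) by simp
next
  fix b i assume "b \<in> (\<lambda>b i. \<phi> (b i)) ` S" "i < k"
  then obtain b' where "b' \<in> S" "b = (\<lambda>i. \<phi> (b' i))" by (elim imageE)
  then show "b i \<in> Y"
    using transversal_designD(1)[OF assms(1)] \<open>i < k\<close> assms(2) by (simp add: bij_betw_apply)
qed

definition has_TD4 :: "nat \<Rightarrow> bool" where
  "has_TD4 n \<longleftrightarrow> (\<exists>S. transversal_design 4 {..<n} S)"

lemma has_TD4I: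
  assumes "transversal_design 4 X S" "finite X" "card X = n"
  shows "has_TD4 n"
proof -
  obtain \<phi> where "bij_betw \<phi> X {..<n}"
    using assms(2,3) by (metis ex_bij_betw_finite_nat lessThan_atLeast0)
  then show ?thesis
    using transversal_design_transfer[OF assms(1)] unfolding has_TD4_def by blast
qed

text \<open>Cramer's rule modulo \<open>n\<close>: any two of the linear forms have a unit as
  determinant, so two prescribed values have a solution \<open>(a, b)\<close>.\<close>

lemma linear_transversal_design:
  fixes n :: int and p q :: "nat \<Rightarrow> int"
  assumes "n > 0"
    and "\<And>i j. i < k \<Longrightarrow> j < k \<Longrightarrow> i \<noteq> j \<Longrightarrow> coprime (p i * q j - p j * q i) n"
  shows "transversal_design k {0..<n} ((\<lambda>(a,b) i. (p i * a + q i * b) mod n) ` ({0..<n} \<times> {0..<n}))"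
    (is "transversal_design k _ ?S")
proof (rule transversal_design_by_card)
  have "card ?S \<le> card ({0..<n} \<times> {0..<n})" by (rule card_image_le) auto
  then show "card ?S \<le> card {0..<n} * card {0..<n}" by (simp add: card_cartesian_product)
next
  fix i j x y assume ij: "i < k" "j < k" "i \<noteq> j" and xy: "x \<in> {0..<n}" "y \<in> {0..<n}"
  obtain e where e: "[(p i * q j - p j * q i) * e = 1] (mod n)"
    using cong_solve_coprime_int assms(2)[OF ij] by blast
  define a b where "a = e * (q j * x - q i * y)" and "b = e * (p i * y - p j * x)"
  have "p i * a + q i * b = (p i * q j - p j * q i) * e * x"
    by (simp add: a_def b_def algebra_simps)
  then have "[p i * a + q i * b = x] (mod n)"
    using cong_scalar_right[OF e, of x] by simp
  moreover have "p j * a + q j * b = (p i * q j - p j * q i) * e * y"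
    by (simp add: a_def b_def algebra_simps)
  then have "[p j * a + q j * b = y] (mod n)"
    using cong_scalar_right[OF e, of y] by simp
  moreover have "(p l * (a mod n) + q l * (b mod n)) mod n = (p l * a + q l * b) mod n" for l
    by (metis mod_add_eq mod_mult_right_eq)
  ultimately have "(p i * (a mod n) + q i * (b mod n)) mod n = x"
     "(p j * (a mod n) + q j * (b mod n)) mod n = y"
    using xy by (simp_all add: cong_def)
  moreover have "(a mod n, b mod n) \<in> {0..<n} \<times> {0..<n}" using assms(1) by auto
  ultimately show "\<exists>b\<in>?S. b i = x \<and> b j = y"
    by (intro bexI[OF _ imageI[of "(a mod n, b mod n)"]]) auto
qed (use assms(1) in auto)

text \<open>The vectors (slope_x i, slope_y i) have pairwise determinants in {1, 2, 3} up to sign, where 3 occurs only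
  for i = 4.\<close>

definition slope_x :: "nat \<Rightarrow> int" where "slope_x i = (if i = 3 then 0 else 1)"
definition slope_y :: "nat \<Rightarrow> int" where "slope_y i = (if i = 3 then 1 else if i = 4 then 3 else int i)"

lemma transversal_design_odd:
  fixes n :: int
  assumes "odd n" "n > 0"
  shows "transversal_design 4 {0..<n}
    ((\<lambda>(a,b) i. (slope_x i * a + slope_y i * b) mod n) ` ({0..<n} \<times> {0..<n}))"
proof (rule linear_transversal_design[OF assms(2)])
  have 2: "coprime 2 n" "coprime (-2) n" using assms by auto
  fix i j :: nat assume "i < 4" "j < 4" "i \<noteq> j"
  then have "i \<in> {0,1,2,3}" "j \<in> {0,1,2,3}" by auto
  with \<open>i \<noteq> j\<close> 2 show "coprime (slope_x i * slope_y j - slope_x j * slope_y i) n"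
    by (auto simp: slope_x_def slope_y_def)
qed

lemma has_TD4_odd:
  assumes "odd n" shows "has_TD4 n"
  using has_TD4I[OF transversal_design_odd[of "int n"]] assms by (auto elim: oddE)

lemma transversal_design_5:
  fixes n :: int
  assumes "coprime n 6" "n > 0"
  shows "transversal_design 5 {0..<n}
    ((\<lambda>(a,b) i. (slope_x i * a + slope_y i * b) mod n) ` ({0..<n} \<times> {0..<n}))"
proof (rule linear_transversal_design[OF assms(2)])
  have "coprime n (2 * 3)" using assms by simp
  then have 2: "coprime 2 n" "coprime 3 n" 
    unfolding coprime_mult_right_iff by (simp_all add: coprime_commute)
  then have 2: "coprime 2 n" "coprime (-2) n" "coprime 3 n" "coprime (-3) n" by simp_all
  fix i j :: nat assume "i < 5" "j < 5" "i \<noteq> j"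
  then have "i \<in> {0,1,2,3,4}" "j \<in> {0,1,2,3,4}" by auto
  with \<open>i \<noteq> j\<close> 2 show "coprime (slope_x i * slope_y j - slope_x j * slope_y i) n"
    by (auto simp: slope_x_def slope_y_def)
qed

text \<open>MacNeish's product: blocks are paired coordinatewise, and each coordinate determines its
  own factor block.\<close>

lemma has_TD4_mult:
  assumes "has_TD4 m" "has_TD4 n"
  shows "has_TD4 (m * n)"
proof -
  obtain S T where S: "transversal_design 4 {..<m} S" and T: "transversal_design 4 {..<n} T"
    using assms by (auto simp: has_TD4_def)
  let ?S = "(\<lambda>(b,c) i. (b i, c i)) ` (S \<times> T)"
  have "transversal_design 4 ({..<m} \<times> {..<n}) ?S"
  proof (rule transversal_designI)
    fix i j p q assume ij: "i < (4::nat)" "j < 4" "i \<noteq> j" and "p \<in> {..<m} \<times> {..<n}" "q \<in> {..<m} \<times> {..<n}"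
    then obtain b c where "b \<in> S" "b i = fst p" "b j = fst q" "c \<in> T" "c i = snd p" "c j = snd q"
      using transversal_designD(2)[OF S ij, of "fst p" "fst q"]
        transversal_designD(2)[OF T ij, of "snd p" "snd q"] by force
    then show "\<exists>b\<in>?S. b i = p \<and> b j = q"
      by (intro bexI[OF _ imageI[of "(b,c)"]]) auto
  next
    fix b c i j l
    assume *: "b \<in> ?S" "c \<in> ?S" "i < 4" "j < 4" "i \<noteq> j" "b i = c i" "b j = c j" "l < (4::nat)"
    then show "b l = c l"
      using transversal_designD(3)[OF S _ _ *(3-5) _ _ *(8)] transversal_designD(3)[OF T _ _ *(3-5) _ _ *(8)]
      by (auto 0 3)
  qed (use transversal_designD(1)[OF S] transversal_designD(1)[OF T] in auto)
  then show ?thesis by (rule has_TD4I) (auto simp: card_cartesian_product)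
qed

section \<open>Cyclic quasi-difference matrices\<close>

definition develop :: "int \<Rightarrow> int \<Rightarrow> (int + nat) list \<Rightarrow> nat \<Rightarrow> int + nat" where
  "develop m g c i = (case c ! i of Inl z \<Rightarrow> Inl ((z + g) mod m) | Inr k \<Rightarrow> Inr k)"

text \<open>The entries \<open>Inr k\<close> are points at infinity, fixed by the development modulo m.\<close>

definition quasi_difference :: "int \<Rightarrow> nat \<Rightarrow> (int + nat) list list \<Rightarrow> bool" where
  "quasi_difference m h cs \<longleftrightarrow> int (length cs) = m + 2 * int h \<and>
    (\<forall>c\<in>set cs. \<forall>i\<in>set [0..<4]. case c ! i of Inl z \<Rightarrow> True | Inr k \<Rightarrow> k < h) \<and>
    (\<forall>i\<in>set [0..<4]. \<forall>j\<in>set [0..<4]. i \<noteq> j \<longrightarrow>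
      (\<forall>d\<in>set [0..m - 1]. \<exists>c\<in>set cs. case c ! i of Inr _ \<Rightarrow> False | Inl a \<Rightarrow>
         (case c ! j of Inr _ \<Rightarrow> False | Inl b \<Rightarrow> (b - a) mod m = d)) \<and>
      (\<forall>k\<in>set [0..<h]. \<exists>c\<in>set cs. isl (c ! i) \<and> c ! j = Inr k))"

text \<open>The definition quantifies over \<open>set [0..<4]\<close> and similar lists so that
  \<open>code_simp\<close> can evaluate it on concrete matrices; the usable bounded forms are
  extracted here.\<close>

lemma quasi_differenceD:
  assumes "quasi_difference m h cs"
  shows "int (length cs) = m + 2 * int h"
    and "c \<in> set cs \<Longrightarrow> i < 4 \<Longrightarrow> c ! i = Inr k \<Longrightarrow> k < h"
    and "i < 4 \<Longrightarrow> j < 4 \<Longrightarrow> i \<noteq> j \<Longrightarrow> 0 \<le> d \<Longrightarrow> d < m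
      \<Longrightarrow> \<exists>c\<in>set cs. \<exists>a b. c ! i = Inl a \<and> c ! j = Inl b \<and> (b - a) mod m = d"
    and "i < 4 \<Longrightarrow> j < 4 \<Longrightarrow> i \<noteq> j \<Longrightarrow> k < h \<Longrightarrow> \<exists>c\<in>set cs. \<exists>a. c ! i = Inl a \<and> c ! j = Inr k"
proof -
  note qd = assms[unfolded quasi_difference_def]
  show "int (length cs) = m + 2 * int h" using qd by blast
  show "k < h" if "c \<in> set cs" "i < 4" "c ! i = Inr k"
  proof -
    have "i \<in> set [0..<4]" using that by simp
    then have "case c ! i of Inl z \<Rightarrow> True | Inr k \<Rightarrow> k < h" using qd that(1) by blast
    then show ?thesis using that(3) by simp
  qed
  show "\<exists>c\<in>set cs. \<exists>a b. c ! i = Inl a \<and> c ! j = Inl b \<and> (b - a) mod m = d"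
    if ij: "i < 4" "j < 4" "i \<noteq> j" and "0 \<le> d" "d < m"
  proof -
    have "i \<in> set [0..<4]" "j \<in> set [0..<4]" "d \<in> set [0..m - 1]" using that by simp_all
    then obtain c where "c \<in> set cs" "case c ! i of Inr _ \<Rightarrow> False | Inl a \<Rightarrow>
         (case c ! j of Inr _ \<Rightarrow> False | Inl b \<Rightarrow> (b - a) mod m = d)"
      using qd ij(3) by blast
    then show ?thesis by (intro bexI[of _ c]) (auto split: sum.splits)
  qed
  show "\<exists>c\<in>set cs. \<exists>a. c ! i = Inl a \<and> c ! j = Inr k"
    if ij: "i < 4" "j < 4" "i \<noteq> j" and "k < h"
  proof -
    have "i \<in> set [0..<4]" "j \<in> set [0..<4]" "k \<in> set [0..<h]" using that by simp_all
    then obtain c where "c \<in> set cs" "isl (c ! i)" "c ! j = Inr k"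
      using qd ij(3) by blast
    then show ?thesis by (auto simp: isl_def)
  qed
qed

text \<open>Translation of the \<open>m + 2 * h\<close> columns gives at most
  \<open>m * (m + 2 * h)\<close> blocks, and the design at infinity adds at most
  \<open>h * h\<close>. Together this is the square of \<open>m + h\<close>, so it suffices that
  every pair of points is met.\<close>

lemma transversal_design_quasi_difference:
  assumes "m > 0" and qd: "quasi_difference m h cs"
    and T: "transversal_design 4 {..<h} T" "finite T" "card T \<le> h * h"
  shows "transversal_design 4 ({0..<m} <+> {..<h})
    ((\<lambda>(g,c). develop m g c) ` ({0..<m} \<times> set cs) \<union> (\<lambda>b i. Inr (b i)) ` T)"
    (is "transversal_design 4 ?X (?D \<union> ?I)")
proof (rule transversal_design_by_card)
  show "finite (?D \<union> ?I)" using T by auto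
  have "card ?D \<le> card ({0..<m} \<times> set cs)" by (rule card_image_le) auto
  also have "\<dots> \<le> nat m * length cs" by (simp add: card_cartesian_product card_length)
  finally have "card ?D \<le> nat m * length cs" .
  moreover have "card ?I \<le> h * h" using card_image_le[OF T(2)] T(3) le_trans by blast
  moreover have "card (?D \<union> ?I) \<le> card ?D + card ?I" by (rule card_Un_le)
  ultimately have "card (?D \<union> ?I) \<le> nat m * length cs + h * h" by linarith
  also have "length cs = nat m + 2 * h" using quasi_differenceD(1)[OF qd] assms(1) by linarith
  also have "nat m * (nat m + 2 * h) + h * h = card ?X * card ?X"
    by (simp add: card_Plus algebra_simps)
  finally show "card (?D \<union> ?I) \<le> card ?X * card ?X" .
next
  fix b i assume b: "b \<in> ?D \<union> ?I" and i: "i < (4::nat)"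
  show "b i \<in> ?X"
  proof (cases "b \<in> ?I")
    case True then show ?thesis using transversal_designD(1)[OF T(1) _ i] by auto
  next
    case False
    then obtain g c where c: "c \<in> set cs" "b = develop m g c" using b by auto
    then show ?thesis
      using quasi_differenceD(2)[OF qd c(1) i] assms(1) by (auto simp: develop_def split: sum.splits)
  qed
next
  fix i j p q assume ij: "i < (4::nat)" "j < 4" "i \<noteq> j" and pq: "p \<in> ?X" "q \<in> ?X"
  have D: "\<exists>b\<in>?D \<union> ?I. P b" if "c \<in> set cs" "P (develop m (g mod m) c)" for P c g
    using that assms(1) by force
  have mixed: "\<exists>b\<in>?D \<union> ?I. b i = Inl x \<and> b j = Inr k"
    if ijk: "i < 4" "j < 4" "i \<noteq> j" "k < h" and "0 \<le> x" "x < m" for i j k x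
  proof -
    obtain c a where "c \<in> set cs" "c ! i = Inl a" "c ! j = Inr k"
      using quasi_differenceD(4)[OF qd ijk] by blast
    then show ?thesis using that by (intro D[of c _ "x - a"]) (auto simp: develop_def mod_simps)
  qed
  show "\<exists>b\<in>?D \<union> ?I. b i = p \<and> b j = q"
  proof (cases p; cases q)
    fix x y assume p: "p = Inl x" and q: "q = Inl y"
    obtain c a b where c: "c \<in> set cs" "c ! i = Inl a" "c ! j = Inl b" "(b - a) mod m = (y - x) mod m"
      using quasi_differenceD(3)[OF qd ij, of "(y - x) mod m"] assms(1) by auto
    have "[(b - a) + x = (y - x) + x] (mod m)"
      by (rule cong_add) (use c(4) in \<open>auto simp: cong_def\<close>)
    then have "(b + (x - a)) mod m = y mod m" by (simp add: cong_def algebra_simps)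
    then show ?thesis
      using p q pq c by (intro D[of c _ "x - a"]) (auto simp: develop_def mod_simps)
  next
    fix x k assume "p = Inl x" "q = Inr k" then show ?thesis using mixed[of i j k x] ij pq by auto
  next
    fix x k assume pq': "p = Inr k" "q = Inl x"
    then have "k < h" "0 \<le> x" "x < m" using pq by auto
    from mixed[OF ij(2,1) ij(3)[symmetric] this]
    obtain b where b: "b \<in> ?D \<union> ?I" "b j = Inl x" "b i = Inr k" by (elim bexE conjE)
    show ?thesis using b(2,3) pq' by (intro bexI[OF _ b(1)]) simp
  next
    fix k l assume pq': "p = Inr k" "q = Inr l"
    then obtain b where "b \<in> T" "b i = k" "b j = l"
      using transversal_designD(2)[OF T(1) ij, of k l] pq by auto
    then show ?thesis using pq' by (intro bexI[of _ "\<lambda>i. Inr (b i)"]) auto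
  qed
qed

lemma transversal_design_singleton: "transversal_design 4 {..<Suc 0} {\<lambda>_. 0}"
  by (rule transversal_designI) auto

text \<open>The first two matrices are orbit representatives of the lines x, y, x + y, x + \<open>\<omega>\<close>y over the fields with 4 and
  8 elements under multiplication, with nonzero elements replaced by their logarithms. In the other two the
  columns come in orbits under cyclic rotation.\<close>

lemma quasi_difference_3_1: "quasi_difference 3 1
  [[Inr 0, Inl 0, Inl 0, Inl 1], [Inl 0, Inr 0, Inl 0, Inl 0], [Inl 0, Inl 0, Inr 0, Inl 2],
   [Inl 0, Inl 1, Inl 2, Inl 1], [Inl 0, Inl 2, Inl 1, Inr 0]]"
  by code_simp

lemma quasi_difference_7_1: "quasi_difference 7 1
  [[Inr 0, Inl 0, Inl 0, Inl 1], [Inl 0, Inr 0, Inl 0, Inl 0], [Inl 0, Inl 0, Inr 0, Inl 3],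
   [Inl 0, Inl 1, Inl 3, Inl 6], [Inl 0, Inl 3, Inl 1, Inl 5], [Inl 0, Inl 2, Inl 6, Inl 1],
   [Inl 0, Inl 6, Inl 2, Inr 0], [Inl 0, Inl 4, Inl 5, Inl 4], [Inl 0, Inl 5, Inl 4, Inl 2]]"
  by code_simp

lemma quasi_difference_7_3: "quasi_difference 7 3
  [[Inr 0, Inl 0, Inl 1, Inl 4], [Inl 4, Inr 0, Inl 0, Inl 1], [Inl 1, Inl 4, Inr 0, Inl 0], [Inl 0, Inl 1, Inl 4, Inr 0],
   [Inr 1, Inl 0, Inl 2, Inl 1], [Inl 1, Inr 1, Inl 0, Inl 2], [Inl 2, Inl 1, Inr 1, Inl 0], [Inl 0, Inl 2, Inl 1, Inr 1],
   [Inr 2, Inl 0, Inl 4, Inl 2], [Inl 2, Inr 2, Inl 0, Inl 4], [Inl 4, Inl 2, Inr 2, Inl 0], [Inl 0, Inl 4, Inl 2, Inr 2],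
   [Inl 0, Inl 0, Inl 0, Inl 0]]"
  by code_simp

lemma quasi_difference_11_3: "quasi_difference 11 3
  [[Inr 0, Inl 0, Inl 1, Inl 3], [Inl 3, Inr 0, Inl 0, Inl 1], [Inl 1, Inl 3, Inr 0, Inl 0], [Inl 0, Inl 1, Inl 3, Inr 0],
   [Inr 1, Inl 0, Inl 3, Inl 10], [Inl 10, Inr 1, Inl 0, Inl 3], [Inl 3, Inl 10, Inr 1, Inl 0], [Inl 0, Inl 3, Inl 10, Inr 1],
   [Inr 2, Inl 0, Inl 4, Inl 9], [Inl 9, Inr 2, Inl 0, Inl 4], [Inl 4, Inl 9, Inr 2, Inl 0], [Inl 0, Inl 4, Inl 9, Inr 2],
   [Inl 0, Inl 6, Inl 4, Inl 1], [Inl 1, Inl 0, Inl 6, Inl 4], [Inl 4, Inl 1, Inl 0, Inl 6], [Inl 6, Inl 4, Inl 1, Inl 0],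
   [Inl 0, Inl 0, Inl 0, Inl 0]]"
  by code_simp

lemma has_TD4_quasi_difference_1:
  assumes "quasi_difference m 1 cs" "m > 0" "n = nat m + 1"
  shows "has_TD4 n"
  using has_TD4I[OF transversal_design_quasi_difference[OF assms(2,1), of "{\<lambda>_. 0}"]]
    transversal_design_singleton assms(3) by (auto simp: card_Plus)

lemma has_TD4_quasi_difference_3:
  assumes "quasi_difference m 3 cs" "m > 0" "n = nat m + 3"
  shows "has_TD4 n"
proof -
  let ?S = "((\<lambda>(a,b) i. (slope_x i * a + slope_y i * b) mod 3) ` ({0..<3} \<times> {0..<3}))"
  let ?T = "(\<lambda>b i. nat (b i)) ` ?S"
  have "bij_betw nat {0..<3} {..<3}"
    by (rule bij_betw_byWitness[of _ int]) auto
  then have T: "transversal_design 4 {..<3} ?T"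
    by (rule transversal_design_transfer[rotated, of nat]) (rule transversal_design_odd, auto)
  have "card ?T \<le> card ({0..<3::int} \<times> {0..<3::int})"
    unfolding image_image by (rule card_image_le) auto
  then have "card ?T \<le> 3 * 3" by (simp add: card_cartesian_product)
  from has_TD4I[OF transversal_design_quasi_difference[OF assms(2,1) T _ this]]
  show ?thesis using assms(3) by (auto simp: card_Plus)
qed

text \<open>There is no design of order 2 to multiply by, so the powers of two are built from the
  orders 4 and 8.\<close>

lemma has_TD4_mult_4:
  assumes "n > 0" shows "has_TD4 (4 * n)"
  using assms
proof (induction n rule: less_induct)
  case (less n)
  have 4: "has_TD4 4" using has_TD4_quasi_difference_1[OF quasi_difference_3_1] by auto
  have 8: "has_TD4 8" using has_TD4_quasi_difference_1[OF quasi_difference_7_1] by auto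
  consider "odd n" | k where "n = 2 * k" "odd k" | k where "n = 4 * k"
    by (metis dvd_def mult.assoc numeral_Bit0_eq_double mult_2 evenE)
  then show ?case
  proof cases
    case 1 then show ?thesis using has_TD4_mult[OF 4 has_TD4_odd] by simp
  next
    case 2 then show ?thesis using has_TD4_mult[OF 8 has_TD4_odd[of k]] by simp
  next
    case 3 then show ?thesis using has_TD4_mult[OF 4 less.IH[of k]] less.prems by simp
  qed
qed


text \<open>Wilson's construction: the fifth group of R is truncated to U, whose points become the points at infinity.
  Blocks of R meeting U are replaced by a copy of B without its block at infinity, the others by a copy of A.\<close>

definition wilson_block :: "(nat \<Rightarrow> 'a) \<Rightarrow> (nat \<Rightarrow> 'b + 'c) \<Rightarrow> nat \<Rightarrow> ('a \<times> 'b) + 'a" where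
  "wilson_block r b = (\<lambda>i. case b i of Inl y \<Rightarrow> Inl (r i, y) | Inr _ \<Rightarrow> Inr (r 4))"

text \<open>Two finite points fix \<open>r\<close> through two of the first four groups, a finite
  point and a point \<open>u\<close> at infinity fix it through \<open>r 4 = u\<close>, and two
  points at infinity lie in a block of \<open>C\<close>. The infinite block of \<open>B\<close> has
  to go: it would give a constant block at \<open>u\<close>, in competition with
  \<open>C\<close>.\<close>

lemma wilson_transversal_design:
  assumes R: "transversal_design 5 X R" and U: "U \<subseteq> X"
    and A: "transversal_design 4 Y A"
    and B: "transversal_design 4 (Y <+> {z}) B" and z: "(\<lambda>_. Inr z) \<in> B"
    and C: "transversal_design 4 U C"
  shows "transversal_design 4 (X \<times> Y <+> U)
    ({\<lambda>i. Inl (r i, a i) | r a. r \<in> R \<and> r 4 \<notin> U \<and> a \<in> A} \<union>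
     {wilson_block r b | r b.
        r \<in> R \<and> r 4 \<in> U \<and> b \<in> B \<and> (\<exists>i<4. b i \<noteq> Inr z)} \<union>
     {\<lambda>i. Inr (c i) | c. c \<in> C})" (is "transversal_design 4 ?V (?S1 \<union> ?S2 \<union> ?S3)")
proof (rule transversal_designI)
  fix b i assume b: "b \<in> ?S1 \<union> ?S2 \<union> ?S3" and i: "i < (4::nat)"
  then have i5: "i < 5" by simp
  consider r a where "b = (\<lambda>i. Inl (r i, a i))" "r \<in> R" "a \<in> A"
    | r d where "b = wilson_block r d" "r \<in> R" "r 4 \<in> U" "d \<in> B"
    | c where "b = (\<lambda>i. Inr (c i))" "c \<in> C"
    using b by blast
  then show "b i \<in> ?V"
  proof cases
    case 1 then show ?thesis using transversal_designD(1)[OF R _ i5] transversal_designD(1)[OF A _ i] by auto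
  next
    case 2 then show ?thesis
      using transversal_designD(1)[OF R _ i5] transversal_designD(1)[OF B 2(4) i]
      by (auto simp: wilson_block_def split: sum.splits)
  next
    case 3 then show ?thesis using transversal_designD(1)[OF C _ i] by auto
  qed
next
  fix i j p q assume ij: "i < (4::nat)" "j < 4" "i \<noteq> j" and pq: "p \<in> ?V" "q \<in> ?V"
  have S2I: "\<exists>b\<in>?S1 \<union> ?S2 \<union> ?S3. P b"
    if "r \<in> R" "r 4 \<in> U" "b \<in> B" "k < 4" "b k \<noteq> Inr z"
      "P (wilson_block r b)" for P r b k
    using that by blast
  have mixed: "\<exists>b\<in>?S1 \<union> ?S2 \<union> ?S3. b i = Inl (x, y) \<and> b j = Inr u"
    if ij: "i < 4" "j < 4" "i \<noteq> j" and xyu: "x \<in> X" "y \<in> Y" "u \<in> U" for i j x y u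
  proof -
    have "u \<in> X" "i < 5" "i \<noteq> 4" using that U by auto
    then obtain r where "r \<in> R" "r i = x" "r 4 = u"
      using transversal_designD(2)[OF R, of i 4 x u] xyu(1) by auto
    moreover obtain b where "b \<in> B" "b i = Inl y" "b j = Inr z"
      using transversal_designD(2)[OF B ij, of "Inl y" "Inr z"] xyu by auto
    ultimately show ?thesis using that by (intro S2I[of r b i]) (auto simp: wilson_block_def)
  qed
  show "\<exists>b\<in>?S1 \<union> ?S2 \<union> ?S3. b i = p \<and> b j = q"
  proof (cases p; cases q)
    fix v w assume vw: "p = Inl v" "q = Inl w"
    obtain x y x' y' where [simp]: "v = (x, y)" "w = (x', y')" by (cases v; cases w)
    obtain r where r: "r \<in> R" "r i = x" "r j = x'"
      using transversal_designD(2)[OF R, of i j x x'] ij pq vw by auto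
    show ?thesis
    proof (cases "r 4 \<in> U")
      case True
      obtain b where "b \<in> B" "b i = Inl y" "b j = Inl y'"
        using transversal_designD(2)[OF B ij, of "Inl y" "Inl y'"] pq vw by auto
      then show ?thesis using True r vw ij by (intro S2I[of r b i]) (auto simp: wilson_block_def)
    next
      case False
      obtain a where "a \<in> A" "a i = y" "a j = y'"
        using transversal_designD(2)[OF A ij, of y y'] pq vw by auto
      then show ?thesis using False r vw by (intro bexI[of _ "\<lambda>i. Inl (r i, a i)"]) auto
    qed
  next
    fix v k assume "p = Inl v" "q = Inr k" then show ?thesis using mixed[of i j "fst v" "snd v" k] ij pq by auto
  next
    fix v k assume pq': "p = Inr k" "q = Inl v"
    then have "fst v \<in> X" "snd v \<in> Y" "k \<in> U" using pq by auto
    from mixed[OF ij(2,1) ij(3)[symmetric] this]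
    obtain b where b: "b \<in> ?S1 \<union> ?S2 \<union> ?S3" "b j = Inl (fst v, snd v)" "b i = Inr k"
      by (elim bexE conjE)
    show ?thesis using b(2,3) pq' by (intro bexI[OF _ b(1)]) simp
  next
    fix k l assume pq': "p = Inr k" "q = Inr l"
    then obtain c where "c \<in> C" "c i = k" "c j = l"
      using transversal_designD(2)[OF C ij, of k l] pq by auto
    then show ?thesis using pq' by (intro bexI[of _ "\<lambda>i. Inr (c i)"]) auto
  qed
next
  fix b c :: "nat \<Rightarrow> ('a \<times> 'b) + 'a" and i j l :: nat
  assume bc: "b \<in> ?S1 \<union> ?S2 \<union> ?S3" "c \<in> ?S1 \<union> ?S2 \<union> ?S3"
    and ij: "i < 4" "j < 4" "i \<noteq> j" and eq: "b i = c i" "b j = c j" and l: "l < 4"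
  have Req: "r k = r' k"
    if "r \<in> R" "r' \<in> R" "r m = r' m" "r m' = r' m'" "m < 5" "m' < 5" "m \<noteq> m'" "k < 5" for r r' m m' k
    using transversal_designD(3)[OF R] that by metis
  have Binf: False if "b \<in> B" "b m = Inr z" "b m' = Inr z" "m < 4" "m' < 4" "m \<noteq> m'" "k < 4" "b k \<noteq> Inr z" for b m m' k
    using transversal_designD(3)[OF B that(1) z that(4,5,6) _ _ that(7)] that by auto
  have Bz: "u = z" if "b \<in> B" "b k = Inr u" "k < 4" for b k u
    using transversal_designD(1)[OF B that(1,3)] that(2) by auto
  have S12: False if H: "b \<in> ?S1" "c \<in> ?S2" "b i = c i" "b j = c j" for b c
  proof -
    obtain r a where b: "b = (\<lambda>i. Inl (r i, a i))" "r \<in> R" "r 4 \<notin> U"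
      using H(1) by blast
    obtain r' d where c: "c = wilson_block r' d" "r' \<in> R" "r' 4 \<in> U" "d \<in> B"
      using H(2) by blast
    have "r i = r' i" "r j = r' j"
      using H(3,4) b(1) c(1) by (auto simp: wilson_block_def split: sum.splits)
    then show False using Req[of r r' i j 4] b c ij by auto
  qed
  have S13: False if "b \<in> ?S1" "c \<in> ?S3" "b i = c i" for b c
    using that by auto
  have S23: False if H: "b \<in> ?S2" "c \<in> ?S3" "b i = c i" "b j = c j" for b c
  proof -
    obtain r d k where b: "b = wilson_block r d" "d \<in> B" "k < 4" "d k \<noteq> Inr z"
      using H(1) by blast
    have "\<exists>u. d i = Inr u" "\<exists>u. d j = Inr u"
      using H(2-4) b(1) by (auto simp: wilson_block_def split: sum.splits)
    then have "d i = Inr z" "d j = Inr z" using Bz[OF b(2)] ij by auto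
    then show False using Binf[OF b(2)] ij b by blast
  qed
  have S22: "b l = c l" if b: "b \<in> ?S2" and c: "c \<in> ?S2"
  proof -
    obtain r d k where b: "b = wilson_block r d"
        "r \<in> R" "d \<in> B" "k < 4" "d k \<noteq> Inr z"
      using b by blast
    obtain r' d' where c: "c = wilson_block r' d'"
        "r' \<in> R" "d' \<in> B"
      using c by blast
    \<comment> \<open>Each agreement yields equality of \<open>r\<close> and \<open>r'\<close> in
      its own group or in group 4. Both cannot be of the second kind, since \<open>d\<close> has at
      most one infinite entry; so two of the five groups fix the block of \<open>R\<close>.\<close>
    have i: "(\<exists>y. d i = Inl y \<and> d' i = Inl y \<and> r i = r' i) \<or> (d i = Inr z \<and> d' i = Inr z \<and> r 4 = r' 4)"
      using eq(1) b(1) c(1) Bz[OF b(3) _ ij(1)] Bz[OF c(3) _ ij(1)] by (auto simp: wilson_block_def split: sum.splits)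
    have j: "(\<exists>y. d j = Inl y \<and> d' j = Inl y \<and> r j = r' j) \<or> (d j = Inr z \<and> d' j = Inr z \<and> r 4 = r' 4)"
      using eq(2) b(1) c(1) Bz[OF b(3) _ ij(2)] Bz[OF c(3) _ ij(2)] by (auto simp: wilson_block_def split: sum.splits)
    have "d i = d' i" "d j = d' j" using i j by auto
    then have d: "d l = d' l"
      using transversal_designD(3)[OF B b(3) c(3) ij _ _ l] by auto
    consider "r i = r' i" "r j = r' j" | "r i = r' i" "r 4 = r' 4" | "r j = r' j" "r 4 = r' 4"
      using i j Binf[OF b(3) _ _ ij b(4,5)] by auto
    then have r: "r k = r' k" if "k < 5" for k
      using Req[OF b(2) c(2), of i j k] Req[OF b(2) c(2), of i 4 k] Req[OF b(2) c(2), of j 4 k] ij that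
      by cases auto
    show ?thesis using b(1) c(1) d r[of l] r[of 4] l by (simp add: wilson_block_def split: sum.splits)
  qed
  have S11: "b l = c l" if H: "b \<in> ?S1" "c \<in> ?S1"
  proof -
    obtain r a where b: "b = (\<lambda>i. Inl (r i, a i))" "r \<in> R" "a \<in> A"
      using H(1) by blast
    obtain r' a' where c: "c = (\<lambda>i. Inl (r' i, a' i))" "r' \<in> R" "a' \<in> A"
      using H(2) by blast
    show ?thesis
      using eq b(1) c(1) Req[OF b(2) c(2), of i j l] transversal_designD(3)[OF A b(3) c(3) ij _ _ l] ij l
      by simp
  qed
  have S33: "b l = c l" if "b \<in> ?S3" "c \<in> ?S3"
    using that eq transversal_designD(3)[OF C _ _ ij _ _ l] by auto
  note eq' = eq[symmetric]
  from bc show "b l = c l"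
  proof (elim UnE)
    assume "b \<in> ?S1" "c \<in> ?S1" then show ?thesis by (rule S11)
  next
    assume "b \<in> ?S2" "c \<in> ?S2" then show ?thesis by (rule S22)
  next
    assume "b \<in> ?S3" "c \<in> ?S3" then show ?thesis by (rule S33)
  next
    assume "b \<in> ?S1" "c \<in> ?S2" from S12[OF this eq] show ?thesis ..
  next
    assume "c \<in> ?S1" "b \<in> ?S2" from S12[OF this eq'] show ?thesis ..
  next
    assume "b \<in> ?S1" "c \<in> ?S3" from S13[OF this eq(1)] show ?thesis ..
  next
    assume "c \<in> ?S1" "b \<in> ?S3" from S13[OF this eq'(1)] show ?thesis ..
  next
    assume "b \<in> ?S2" "c \<in> ?S3" from S23[OF this eq] show ?thesis ..
  next
    assume "c \<in> ?S2" "b \<in> ?S3" from S23[OF this eq'] show ?thesis ..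
  qed
qed

lemma has_TD4_wilson:
  assumes "coprime t 6" "t > 0" "odd u" "u \<le> t"
  shows "has_TD4 (3 * t + u)"
proof -
  obtain R where R: "transversal_design 5 {0..<int t} R"
    using transversal_design_5[of "int t"] assms(1,2) by (metis coprime_int_iff of_nat_0_less_iff of_nat_numeral)
  obtain A where A: "transversal_design 4 {0..<3::int} A"
    using transversal_design_odd[of 3] by auto
  obtain C where C: "transversal_design 4 {0..<int u} C"
    using transversal_design_odd[of "int u"] assms(3) by (auto elim: oddE)
  obtain B where B: "transversal_design 4 ({0..<3::int} <+> {0::nat}) B" "(\<lambda>_. Inr 0) \<in> B"
    using transversal_design_quasi_difference[OF _ quasi_difference_3_1, of "{\<lambda>_. 0}"]
      transversal_design_singleton by (auto simp: lessThan_Suc)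
  show ?thesis
    using assms(4) by (intro has_TD4I[OF wilson_transversal_design[OF R _ A B C]])
      (auto simp: card_Plus card_cartesian_product)
qed

text \<open>Wilson's construction reaches \<open>n\<close> if \<open>3 * t < n \<le> 4 * t\<close>
  for some \<open>t\<close> prime to 6; \<open>n - 3 * t\<close> is then odd because
  \<open>n\<close> is even and \<open>t\<close> odd. For \<open>n = 4 * q - 2\<close> the upper
  bound means \<open>q \<le> t\<close>.\<close>

lemma has_TD4_2_mod_4:
  assumes "n mod 4 = 2" "n \<ge> 10" shows "has_TD4 n"
proof -
  have W: "has_TD4 n" if "t mod 6 = 1 \<or> t mod 6 = 5" "3 * t < n" "n \<le> 4 * t" for t
  proof -
    have "coprime t 6"
    proof -
      have "coprime (t mod 6) 6" using that(1) by (elim disjE) (simp_all add: coprime_iff_gcd_eq_1 gcd_nat.simps)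
      then show ?thesis by simp
    qed
    moreover have "odd t" using that(1) by presburger
    then have "odd (n - 3 * t)" using \<open>n mod 4 = 2\<close> that(2) by presburger
    ultimately have "has_TD4 (3 * t + (n - 3 * t))" using that by (intro has_TD4_wilson) auto
    then show ?thesis using that by simp
  qed
  \<comment> \<open>The orders 10, 14 and 30 lie in none of the intervals from \<open>3 * t\<close>
    to \<open>4 * t\<close>.\<close>
  have 10: "has_TD4 10" using has_TD4_quasi_difference_3[OF quasi_difference_7_3] by auto
  have 14: "has_TD4 14" using has_TD4_quasi_difference_3[OF quasi_difference_11_3] by auto
  have 30: "has_TD4 30" using has_TD4_mult[OF has_TD4_odd[of 3] 10] by simp
  define q where "q = (n + 2) div 4"
  have q: "n + 2 = 4 * q" using \<open>n mod 4 = 2\<close> unfolding q_def by presburger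
  have "q = 3 \<or> q = 4 \<or> q = 5 \<or> q = 6 \<or> q = 7 \<or> q = 8 \<or> q = 9 \<or> q = 10 \<or> q = 11 \<or> q > 11"
    using q assms(2) by linarith
  then consider "n = 10" | "n = 14" | "n = 30" | "n = 18" | "n = 22 \<or> n = 26" | "n = 34 \<or> n = 38 \<or> n = 42" | "n > 42"
    using q by auto
  then show ?thesis
  proof cases
    case 4 then show ?thesis using W[of 5] by simp
  next
    case 5 then show ?thesis using W[of 7] by auto
  next
    case 6 then show ?thesis using W[of 11] by auto
  next
    case 7
    \<comment> \<open>The distance from \<open>q\<close> to the next number that is 1 or 5 modulo 6;
      it is at most 3. The condition \<open>3 * (q + 3) < 4 * q - 2\<close> means
      \<open>q > 11\<close>, hence the bound 42.\<close>
    define d :: nat where "d = (if q mod 6 = 0 then 1 else if q mod 6 = 2 then 3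
      else if q mod 6 = 3 then 2 else if q mod 6 = 4 then 1 else 0)"
    define t where "t = q + d"
    have "q mod 6 < 6" by simp
    then consider "q mod 6 = 0" | "q mod 6 = 1" | "q mod 6 = 2" | "q mod 6 = 3" | "q mod 6 = 4" | "q mod 6 = 5"
      by linarith
    then have "(q mod 6 + d) mod 6 = 1 \<or> (q mod 6 + d) mod 6 = 5" "d \<le> 3"
      by (cases; simp add: d_def)+
    then have "q \<le> t" "t \<le> q + 3" "t mod 6 = 1 \<or> t mod 6 = 5"
      by (simp_all add: t_def mod_add_left_eq)
    then show ?thesis using W[of t] q 7 by simp
  qed (use 10 14 30 in auto)
qed

section \<open>Two-factorizations of \<open>C_M[n]\<close>\<close>

lemma card_cycle_edges:
  assumes "is_k_cycle k vs"
  shows "card (cycle_edges vs) = k"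
proof -
  have k: "k \<ge> 3" "length vs = k" "distinct vs" using assms by (auto simp: is_k_cycle_def)
  let ?f = "\<lambda>i. {vs ! i, vs ! (Suc i mod k)}"
  have "inj_on ?f {..<k}"
  proof (rule inj_onI)
    fix i j assume ij: "i \<in> {..<k}" "j \<in> {..<k}" "?f i = ?f j"
    have nth: "vs ! a = vs ! b \<longleftrightarrow> a = b" if "a < k" "b < k" for a b
      using that k by (simp add: nth_eq_iff_index_eq)
    have lt: "i < k" "j < k" "Suc i mod k < k" "Suc j mod k < k" using ij k by auto
    have "vs ! i = vs ! j \<or> (vs ! i = vs ! (Suc j mod k) \<and> vs ! (Suc i mod k) = vs ! j)"
      using ij(3) by (auto simp: doubleton_eq_iff)
    then have "i = j \<or> (i = Suc j mod k \<and> Suc i mod k = j)"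
      using nth lt by simp
    \<comment> \<open>The second alternative, one edge read in both directions, would force a cycle
      of length at most 2.\<close>
    then show "i = j" using lt k(1) by (auto simp: mod_Suc split: if_splits)
  qed
  moreover have "cycle_edges vs = ?f ` {..<k}" using k by (auto simp: cycle_edges_def)
  ultimately show ?thesis by (simp add: card_image)
qed

lemma cycle_edges_subset:
  assumes "e \<in> cycle_edges vs"
  shows "e \<subseteq> set vs" "e \<noteq> {}"
proof -
  obtain i where i: "i < length vs" "e = {vs ! i, vs ! (Suc i mod length vs)}"
    using assms by (auto simp: cycle_edges_def)
  then have "Suc i mod length vs < length vs" by (intro mod_less_divisor) auto
  then show "e \<subseteq> set vs" "e \<noteq> {}" using i by auto
qed

text \<open>Every cycle has as many edges as vertices. The value does not depend on
  \<open>k\<close>, so factors of both lengths count alike when a decomposition is checked.\<close>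

lemma card_Ck_factor:
  assumes "is_Ck_factor V E k F" "finite V"
  shows "card F = card V"
proof -
  obtain Cs where Cs: "\<forall>vs\<in>Cs. is_k_cycle k vs"
      "\<forall>vs\<in>Cs. \<forall>ws\<in>Cs. vs \<noteq> ws \<longrightarrow> set vs \<inter> set ws = {}"
      "(\<Union>vs\<in>Cs. set vs) = V" "F = (\<Union>vs\<in>Cs. cycle_edges vs)"
    using assms(1) by (auto simp: is_Ck_factor_def)
  have "Cs \<subseteq> {vs. set vs \<subseteq> V \<and> length vs = k}" using Cs(1,3) by (auto simp: is_k_cycle_def)
  then have fin: "finite Cs" using finite_lists_length_eq[OF assms(2)] finite_subset by blast
  have "card F = (\<Sum>vs\<in>Cs. card (cycle_edges vs))"
    unfolding Cs(4)
  proof (rule card_UN_disjoint[OF fin])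
    show "\<forall>vs\<in>Cs. finite (cycle_edges vs)" by (auto simp: cycle_edges_def)
    show "\<forall>vs\<in>Cs. \<forall>ws\<in>Cs. vs \<noteq> ws \<longrightarrow> cycle_edges vs \<inter> cycle_edges ws = {}"
    proof (intro ballI impI, rule ccontr)
      fix vs ws assume v: "vs \<in> Cs" "ws \<in> Cs" "vs \<noteq> ws" and "cycle_edges vs \<inter> cycle_edges ws \<noteq> {}"
      then obtain e where "e \<in> cycle_edges vs" "e \<in> cycle_edges ws" by blast
      then have "e \<subseteq> set vs \<inter> set ws" "e \<noteq> {}" using cycle_edges_subset[of e] by auto
      then show False using Cs(2) v by auto
    qed
  qed
  also have "\<dots> = (\<Sum>vs\<in>Cs. card (set vs))"
    using Cs(1) by (intro sum.cong) (auto simp: card_cycle_edges is_k_cycle_def distinct_card)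
  also have "\<dots> = card V"
    unfolding Cs(3)[symmetric] by (rule card_UN_disjoint[symmetric, OF fin]) (use Cs(2) in auto)
  finally show ?thesis .
qed

section \<open>Oriented edges and a criterion for decompositions\<close>

definition arc :: "nat \<Rightarrow> nat \<Rightarrow> nat \<Rightarrow> nat \<Rightarrow> (nat \<times> nat) set" where
  "arc M i x y = {(i, x), ((i + 1) mod M, y)}"

lemma lexC_edges_eq:
  assumes "M > 0"
  shows "lexC_edges M n = (\<lambda>(i, x, y). arc M i x y) ` ({..<M} \<times> {..<n} \<times> {..<n})"
proof (intro equalityI subsetI)
  fix e assume "e \<in> lexC_edges M n"
  then obtain i x j y where e: "e = {(i, x), (j, y)}" "i < M" "x < n" "j < M" "y < n"
    "j = (i + 1) mod M \<or> i = (j + 1) mod M"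
    unfolding lexC_edges_def by blast
  then have "e = arc M i x y \<or> e = arc M j y x" by (auto simp: arc_def)
  then show "e \<in> (\<lambda>(i, x, y). arc M i x y) ` ({..<M} \<times> {..<n} \<times> {..<n})"
    using e by force
next
  fix e assume "e \<in> (\<lambda>(i, x, y). arc M i x y) ` ({..<M} \<times> {..<n} \<times> {..<n})"
  then obtain i x y where "i < M" "x < n" "y < n" "e = arc M i x y" by auto
  moreover have "(i + 1) mod M < M" using assms by simp
  ultimately show "e \<in> lexC_edges M n" unfolding lexC_edges_def arc_def by blast
qed

lemma card_lexC_edges_le:
  assumes "M > 0"
  shows "finite (lexC_edges M n)" "card (lexC_edges M n) \<le> n * (M * n)"
proof -
  show "finite (lexC_edges M n)" by (simp add: lexC_edges_eq[OF assms])
  have "card (lexC_edges M n) \<le> card ({..<M} \<times> {..<n} \<times> {..<n})"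
    unfolding lexC_edges_eq[OF assms] by (rule card_image_le) auto
  then show "card (lexC_edges M n) \<le> n * (M * n)" by (simp add: card_cartesian_product ac_simps)
qed

text \<open>With at least three layers, the step from \<open>i\<close> to \<open>i + 1\<close> is
  never also a step from \<open>i + 1\<close> to its successor, so an edge has only one
  orientation.\<close>

lemma arc_inject:
  assumes "M \<ge> 3" "i < M" "j < M" "arc M i x y = arc M j x' y'"
  shows "i = j \<and> x = x' \<and> y = y'"
proof -
  have ne: "i \<noteq> (i + 1) mod M" "\<not> (i = (j + 1) mod M \<and> (i + 1) mod M = j)"
    using assms(1-3) by (auto simp: mod_Suc split: if_splits)
  then have "i = j" using assms(4) by (auto simp: arc_def doubleton_eq_iff)
  then show ?thesis using assms(4) ne by (auto simp: arc_def doubleton_eq_iff)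
qed

text \<open>A factor is described by a predicate D: the edge from (i, x) to (i + 1, y) is available if \<open>D i x y\<close> holds.\<close>

definition arc_step :: "nat \<Rightarrow> nat \<Rightarrow> (nat \<Rightarrow> nat \<Rightarrow> nat \<Rightarrow> bool) \<Rightarrow> nat \<times> nat \<Rightarrow> nat \<times> nat \<Rightarrow> bool" where
  "arc_step M n D v w \<longleftrightarrow> (\<exists>i<M. \<exists>x<n. \<exists>y<n. D i x y \<and> {v, w} = arc M i x y)"

lemma arc_step_sym: "arc_step M n D v w \<Longrightarrow> arc_step M n D w v"
  by (simp add: arc_step_def insert_commute)

text \<open>The cycles merely stay within the edges that \<open>D\<close> allows; that nothing is
  left over comes from the edge count in \<open>HWP_intro\<close>.\<close>

definition cycle_factorable :: "nat \<Rightarrow> nat \<Rightarrow> nat \<Rightarrow> (nat \<Rightarrow> nat \<Rightarrow> nat \<Rightarrow> bool) \<Rightarrow> bool" where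
  "cycle_factorable M n k D \<longleftrightarrow> (\<exists>Cs.
     (\<forall>vs\<in>Cs. is_k_cycle k vs \<and> successively (arc_step M n D) vs \<and> arc_step M n D (last vs) (hd vs)) \<and>
     (\<forall>vs\<in>Cs. \<forall>ws\<in>Cs. vs \<noteq> ws \<longrightarrow> set vs \<inter> set ws = {}) \<and>
     (\<Union>vs\<in>Cs. set vs) = lexC_verts M n)"

lemma cycle_edges_successively:
  assumes "e \<in> cycle_edges vs" "successively P vs" "P (last vs) (hd vs)"
  shows "\<exists>v w. e = {v, w} \<and> P v w"
proof -
  obtain i where i: "i < length vs" "e = {vs ! i, vs ! (Suc i mod length vs)}"
    using assms by (auto simp: cycle_edges_def)
  show ?thesis
  proof (cases "Suc i < length vs")
    case True
    then show ?thesis using i assms(2) by (auto simp: successively_conv_nth)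
  next
    case False
    then have "Suc i = length vs" using i by simp
    then have "i = length vs - 1" "vs \<noteq> []" "Suc i mod length vs = 0" by auto
    then show ?thesis using i(2) assms(3) by (auto simp: last_conv_nth hd_conv_nth)
  qed
qed

lemma cycle_factorable_imp_factor:
  assumes "cycle_factorable M n k D" "M > 0"
  shows "\<exists>F. is_Ck_factor (lexC_verts M n) (lexC_edges M n) k F \<and>
    (\<forall>e\<in>F. \<exists>i<M. \<exists>x<n. \<exists>y<n. D i x y \<and> e = arc M i x y)"
proof -
  obtain Cs where Cs:
     "\<forall>vs\<in>Cs. is_k_cycle k vs \<and> successively (arc_step M n D) vs \<and> arc_step M n D (last vs) (hd vs)"
     "\<forall>vs\<in>Cs. \<forall>ws\<in>Cs. vs \<noteq> ws \<longrightarrow> set vs \<inter> set ws = {}"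
     "(\<Union>vs\<in>Cs. set vs) = lexC_verts M n"
    using assms by (auto simp: cycle_factorable_def)
  define F where "F = (\<Union>vs\<in>Cs. cycle_edges vs)"
  have F: "\<exists>i<M. \<exists>x<n. \<exists>y<n. D i x y \<and> e = arc M i x y" if "e \<in> F" for e
  proof -
    obtain vs where vs: "vs \<in> Cs" "e \<in> cycle_edges vs" using \<open>e \<in> F\<close> by (auto simp: F_def)
    then obtain v w where "e = {v, w}" "arc_step M n D v w"
      using cycle_edges_successively[of e vs "arc_step M n D"] Cs(1) by blast
    then show ?thesis by (auto simp: arc_step_def)
  qed
  have "F \<subseteq> lexC_edges M n"
    unfolding lexC_edges_eq[OF assms(2)] using F by fastforce
  then have "is_Ck_factor (lexC_verts M n) (lexC_edges M n) k F"
    unfolding is_Ck_factor_def using Cs F_def by (intro conjI exI[of _ Cs]) auto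
  then show ?thesis using F by (intro exI[of _ F]) simp
qed

text \<open>Disjointness suffices, because the factors have as many edges as the graph in total.\<close>

lemma HWP_intro:
  assumes M: "M \<ge> 3" and H: "H \<subseteq> {..<n}" "card H = y"
    and fac: "\<And>t. t < n \<Longrightarrow> cycle_factorable M n (if t \<in> H then M * n else M) (D t)"
    and disj: "\<And>t t' i x z. t < n \<Longrightarrow> t' < n \<Longrightarrow> i < M \<Longrightarrow> x < n \<Longrightarrow> z < n \<Longrightarrow> D t i x z \<Longrightarrow> D t' i x z \<Longrightarrow> t = t'"
  shows "(n - y, y) \<in> HWP (lexC_verts M n) (lexC_edges M n) M (M * n)"
proof -
  let ?V = "lexC_verts M n" and ?E = "lexC_edges M n"
  have M0: "M > 0" using M by simp
  have "\<forall>t. t < n \<longrightarrow> (\<exists>F. is_Ck_factor ?V ?E (if t \<in> H then M * n else M) F \<and>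
    (\<forall>e\<in>F. \<exists>i<M. \<exists>x<n. \<exists>z<n. D t i x z \<and> e = arc M i x z))"
    using cycle_factorable_imp_factor[OF fac M0] by blast
  then obtain F where F: "\<And>t. t < n \<Longrightarrow> is_Ck_factor ?V ?E (if t \<in> H then M * n else M) (F t)"
    "\<And>t e. t < n \<Longrightarrow> e \<in> F t \<Longrightarrow> \<exists>i<M. \<exists>x<n. \<exists>z<n. D t i x z \<and> e = arc M i x z"
    by metis
  have Fdisj: "F t \<inter> F t' = {}" if t: "t < n" "t' < n" "t \<noteq> t'" for t t'
  proof (rule ccontr)
    assume "F t \<inter> F t' \<noteq> {}"
    then obtain e where "e \<in> F t" "e \<in> F t'" by blast
    from F(2)[OF t(1) this(1)] F(2)[OF t(2) this(2)]
    obtain i x z i' x' z' where "i < M" "x < n" "z < n" "D t i x z" "arc M i x z = arc M i' x' z'"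
      "i' < M" "D t' i' x' z'" by metis
    then show False using arc_inject[OF M] disj[OF t(1,2)] t(3) by metis
  qed
  have finV: "finite ?V" and cardV: "card ?V = M * n"
    by (auto simp: lexC_verts_def card_cartesian_product)
  have sub: "F t \<subseteq> ?E" if "t < n" for t using F(1)[OF that] by (simp add: is_Ck_factor_def)
  have finF: "finite (F t)" if "t < n" for t
    using sub[OF that] card_lexC_edges_le(1)[OF M0] finite_subset by blast
  have "card (\<Union>t\<in>{..<n}. F t) = (\<Sum>t<n. card (F t))"
    using finF Fdisj by (intro card_UN_disjoint) auto
  also have "\<dots> = n * (M * n)"
    using card_Ck_factor[OF F(1) finV] cardV by simp
  finally have cover: "(\<Union>t<n. F t) = ?E"
    using card_lexC_edges_le[OF M0] sub by (intro card_seteq) auto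
  have yn: "y \<le> n" using H card_mono[of "{..<n}" H] by auto
  have finH: "finite H" using H finite_subset by blast
  have "card ({..<n} - H) = n - y" using H finH by (simp add: card_Diff_subset)
  \<comment> \<open>\<open>HWP\<close> lists the short factors before the long ones, whereas
    \<open>H\<close> is an arbitrary set of indices; \<open>g1\<close> and \<open>g2\<close> are
    glued to a renumbering.\<close>
  then obtain g1 where g1: "bij_betw g1 {..<n - y} ({..<n} - H)"
    using finite_same_card_bij[of "{..<n - y}" "{..<n} - H"] by auto
  obtain g2 where g2: "bij_betw g2 {n - y..<n} H"
    using finite_same_card_bij[of "{n - y..<n}" H] finH H yn by auto
  define g where "g i = (if i < n - y then g1 i else g2 i)" for i
  have b1: "bij_betw g {..<n - y} ({..<n} - H)"
    using g1 by (subst bij_betw_cong[of _ _ g1]) (auto simp: g_def)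
  have b2: "bij_betw g {n - y..<n} H"
    using g2 by (subst bij_betw_cong[of _ _ g2]) (auto simp: g_def)
  have "bij_betw g ({..<n - y} \<union> {n - y..<n}) (({..<n} - H) \<union> H)"
    by (rule bij_betw_combine[OF b1 b2]) auto
  moreover have "{..<n - y} \<union> {n - y..<n} = {..<n}" "({..<n} - H) \<union> H = {..<n}" using yn H by auto
  ultimately have g: "bij_betw g {..<n} {..<n}" by simp
  have gn: "g i < n" if "i < n" for i using g that by (auto simp: bij_betw_def)
  have gH: "g i \<in> H \<longleftrightarrow> n - y \<le> i" if "i < n" for i
    using bij_betw_apply[OF b1, of i] bij_betw_apply[OF b2, of i] that by (cases "i < n - y") auto
  have e: "n - y + y = n" using yn by simp
  show ?thesis unfolding HWP_def mem_Collect_eq prod.case e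
  proof (intro exI[of _ "\<lambda>i. F (g i)"] conjI allI impI)
    fix i assume "i < n - y" then show "is_Ck_factor ?V ?E M (F (g i))"
      using F(1)[OF gn, of i] gH[of i] by auto
  next
    fix i assume "n - y \<le> i \<and> i < n" then show "is_Ck_factor ?V ?E (M * n) (F (g i))"
      using F(1)[OF gn, of i] gH[of i] by auto
  next
    fix i j assume ij: "i < n" "j < n" "i \<noteq> j"
    then have "g i \<noteq> g j" using g by (auto simp: bij_betw_def inj_on_def)
    then show "F (g i) \<inter> F (g j) = {}" using Fdisj[OF gn gn] ij by simp
  next
    have "(\<Union>i<n. F (g i)) = (\<Union>t\<in>g ` {..<n}. F t)" by simp
    moreover have "g ` {..<n} = {..<n}" using g by (simp add: bij_betw_def)
    ultimately show "(\<Union>i<n. F (g i)) = ?E" using cover by (simp only:)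
  qed
qed

text \<open>A list of \<open>M * n\<close> entries that covers \<open>M * n\<close> vertices cannot
  repeat one, so only adjacency and covering have to be verified for Hamilton cycles.\<close>

lemma hamilton_factorable:
  assumes "length vs = M * n" "lexC_verts M n \<subseteq> set vs" "M * n \<ge> 3"
    and "successively (arc_step M n D) vs" "arc_step M n D (last vs) (hd vs)"
  shows "cycle_factorable M n (M * n) D"
proof -
  have card: "card (lexC_verts M n) = M * n" by (auto simp: lexC_verts_def card_cartesian_product)
  have "card (set vs) \<le> M * n" using card_length[of vs] assms(1) by simp
  then have eq: "lexC_verts M n = set vs" using card assms(2) by (intro card_seteq) auto
  then have "distinct vs" using card assms(1) by (intro card_distinct) simp
  then show ?thesis unfolding cycle_factorable_def
    using assms eq by (intro exI[of _ "{vs}"]) (auto simp: is_k_cycle_def)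
qed

lemma successively_concat:
  assumes "\<And>xs. xs \<in> set xss \<Longrightarrow> xs \<noteq> [] \<and> successively P xs"
    and "successively (\<lambda>xs ys. P (last xs) (hd ys)) xss"
  shows "successively P (concat xss)"
  using assms
proof (induction xss)
  case (Cons xs xss)
  then show ?case
    by (cases xss) (auto simp: successively_append_iff successively_Cons)
qed auto

lemma successively_upt: "(\<And>i. a \<le> i \<Longrightarrow> Suc i < b \<Longrightarrow> P i (Suc i)) \<Longrightarrow> successively P [a..<b]"
  by (auto simp: successively_conv_nth)

section \<open>Cyclic rows\<close>

definition pt :: "nat \<Rightarrow> nat \<Rightarrow> int \<Rightarrow> nat \<times> nat" where
  "pt n i z = (i, nat (z mod int n))"

lemma pt_eq_iff: "n > 0 \<Longrightarrow> pt n i z = pt n j w \<longleftrightarrow> i = j \<and> [z = w] (mod int n)"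
  by (auto simp: pt_def cong_def eq_nat_nat_iff)

lemma pt_in_verts: "n > 0 \<Longrightarrow> i < M \<Longrightarrow> pt n i z \<in> lexC_verts M n"
  by (auto simp: pt_def lexC_verts_def nat_less_iff)

lemma lexC_vertsE:
  assumes "v \<in> lexC_verts M n"
  obtains i z where "i < M" "v = pt n i z"
proof
  show "fst v < M" "v = pt n (fst v) (int (snd v))"
    using assms by (auto simp: lexC_verts_def pt_def)
qed

lemma arc_step_pt:
  assumes "n > 0" "i < M" "j = (i + 1) mod M" "D i (nat (z mod int n)) (nat (w mod int n))"
  shows "arc_step M n D (pt n i z) (pt n j w)" "arc_step M n D (pt n j w) (pt n i z)"
proof -
  have "nat (z mod int n) < n" "nat (w mod int n) < n" using assms(1) by (auto simp: nat_less_iff)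
  then show "arc_step M n D (pt n i z) (pt n j w)"
    using assms unfolding arc_step_def arc_def pt_def by blast
  then show "arc_step M n D (pt n j w) (pt n i z)" by (rule arc_step_sym)
qed

definition shift_rel :: "nat \<Rightarrow> (nat \<Rightarrow> int) \<Rightarrow> nat \<Rightarrow> nat \<Rightarrow> nat \<Rightarrow> bool" where
  "shift_rel n s i x y \<longleftrightarrow> [int y = int x + s i] (mod int n)"

lemma shift_rel_mod:
  assumes "n > 0"
  shows "shift_rel n s i (nat (z mod int n)) (nat (w mod int n)) \<longleftrightarrow> [w = z + s i] (mod int n)"
  using assms by (simp add: shift_rel_def cong_def mod_simps)

text \<open>One turn through the layers; the closing edge leads to layer 0 at
  \<open>z + sum s {..<M}\<close>, where either the cycle closes or the next strand begins.\<close>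

definition strand :: "nat \<Rightarrow> nat \<Rightarrow> (nat \<Rightarrow> int) \<Rightarrow> int \<Rightarrow> (nat \<times> nat) list" where
  "strand M n s z = map (\<lambda>i. pt n i (z + sum s {..<i})) [0..<M]"

lemma length_strand [simp]: "length (strand M n s z) = M"
  by (simp add: strand_def)

lemma hd_strand: "M > 0 \<Longrightarrow> hd (strand M n s z) = pt n 0 z"
  by (simp add: strand_def hd_map)

lemma strand_successively:
  assumes "n > 0"
  shows "successively (arc_step M n (shift_rel n s)) (strand M n s z)"
  unfolding strand_def successively_map
  by (rule successively_upt, rule arc_step_pt(1))
     (use assms in \<open>auto simp: shift_rel_mod ac_simps\<close>)

lemma strand_last_step:
  assumes "n > 0" "M > 0" "[w = z + sum s {..<M}] (mod int n)"
  shows "arc_step M n (shift_rel n s) (last (strand M n s z)) (pt n 0 w)"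
proof -
  obtain m where m: "M = Suc m" using assms(2) by (cases M) auto
  show ?thesis
    unfolding strand_def m using assms
    by (auto simp: m shift_rel_mod ac_simps intro!: arc_step_pt(1))
qed

lemma pt_in_strand:
  assumes "n > 0" "i < M" "[w = z + sum s {..<i}] (mod int n)"
  shows "pt n i w \<in> set (strand M n s z)"
  using assms by (auto simp: strand_def pt_eq_iff intro!: image_eqI[of _ _ i])

lemma shift_factorable_zero:
  assumes M: "M \<ge> 3" and n: "n > 0" and sum: "[sum s {..<M} = 0] (mod int n)"
  shows "cycle_factorable M n M (shift_rel n s)"
  unfolding cycle_factorable_def
proof (intro exI[of _ "strand M n s ` {0..<int n}"] conjI)
  show "\<forall>vs\<in>strand M n s ` {0..<int n}. is_k_cycle M vs \<and>
     successively (arc_step M n (shift_rel n s)) vs \<and> arc_step M n (shift_rel n s) (last vs) (hd vs)"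
  proof (intro ballI conjI)
    fix vs assume "vs \<in> strand M n s ` {0..<int n}"
    then obtain z where vs: "vs = strand M n s z" by auto
    show "is_k_cycle M vs"
      using M n by (auto simp: vs is_k_cycle_def strand_def distinct_map inj_on_def pt_eq_iff)
    show "successively (arc_step M n (shift_rel n s)) vs" using strand_successively n vs by simp
    have "[z = z + sum s {..<M}] (mod int n)"
      using cong_add[OF cong_refl cong_sym[OF sum], of z] by simp
    then show "arc_step M n (shift_rel n s) (last vs) (hd vs)"
      using strand_last_step n M vs by (simp add: hd_strand)
  qed
  show "\<forall>vs\<in>strand M n s ` {0..<int n}. \<forall>ws\<in>strand M n s ` {0..<int n}. vs \<noteq> ws \<longrightarrow> set vs \<inter> set ws = {}"
  proof (intro ballI impI)
    fix vs ws assume "vs \<in> strand M n s ` {0..<int n}" "ws \<in> strand M n s ` {0..<int n}" "vs \<noteq> ws"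
    then obtain z w where zw: "vs = strand M n s z" "ws = strand M n s w" "z \<noteq> w"
      "z \<in> {0..<int n}" "w \<in> {0..<int n}" by (elim imageE) metis
    show "set vs \<inter> set ws = {}"
    proof (rule ccontr)
      assume "set vs \<inter> set ws \<noteq> {}"
      then have "[z = w] (mod int n)"
        using zw n by (auto simp: strand_def pt_eq_iff cong_add_rcancel cong_sym_eq)
      then show False using zw by (auto simp: cong_def)
    qed
  qed
  show "(\<Union>vs\<in>strand M n s ` {0..<int n}. set vs) = lexC_verts M n"
  proof (intro equalityI subsetI)
    fix v assume "v \<in> lexC_verts M n"
    then obtain i w where iw: "i < M" "v = pt n i w" by (rule lexC_vertsE)
    have "v \<in> set (strand M n s ((w - sum s {..<i}) mod int n))"
      unfolding iw(2) by (rule pt_in_strand[OF n iw(1)]) (simp add: cong_def mod_simps)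
    moreover have "(w - sum s {..<i}) mod int n \<in> {0..<int n}" using n by simp
    ultimately show "v \<in> (\<Union>vs\<in>strand M n s ` {0..<int n}. set vs)" by blast
  qed (use pt_in_verts[OF n] in \<open>auto simp: strand_def\<close>)
qed

text \<open>Strands are joined end to end, each starting one total shift further than the last.
  Multiples of a unit run through all residues, so \<open>n\<close> strands cover every
  layer.\<close>

lemma shift_factorable_coprime:
  assumes M: "M \<ge> 3" and n: "n > 0" and cop: "coprime (sum s {..<M}) (int n)"
  shows "cycle_factorable M n (M * n) (shift_rel n s)"
proof (rule hamilton_factorable)
  let ?R = "sum s {..<M}"
  let ?B = "\<lambda>j. strand M n s (int j * ?R)"
  let ?vs = "concat (map ?B [0..<n])"
  show "length ?vs = M * n" by (simp add: length_concat comp_def sum_list_triv)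
  show "M * n \<ge> 3" using M n by (metis One_nat_def Suc_leI mult.right_neutral mult_le_mono)
  have M0: "M > 0" using M by simp
  have ne: "?B j \<noteq> []" for j using M0 by (metis length_strand length_0_conv less_irrefl)
  show "successively (arc_step M n (shift_rel n s)) ?vs"
  proof (rule successively_concat)
    show "successively (\<lambda>xs ys. arc_step M n (shift_rel n s) (last xs) (hd ys)) (map ?B [0..<n])"
      unfolding successively_map hd_strand[OF M0]
      by (rule successively_upt) (auto intro!: strand_last_step[OF n M0] simp: algebra_simps)
  qed (use strand_successively[OF n] ne in auto)
  obtain m where m: "n = Suc m" using n by (cases n) auto
  have "last ?vs = last (?B m)" using ne by (simp add: m)
  moreover have "hd ?vs = pt n 0 0"
    using ne[of 0] M0 hd_strand[OF M0, of n s 0] by (simp add: m upt_conv_Cons hd_append del: upt_Suc)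
  moreover have "[0 = int m * ?R + ?R] (mod int n)"
  proof -
    have "int m * ?R + ?R = int n * ?R" by (simp add: m algebra_simps)
    then show ?thesis by (simp add: cong_def)
  qed
  ultimately show "arc_step M n (shift_rel n s) (last ?vs) (hd ?vs)"
    using strand_last_step[OF n M0] by simp
  show "lexC_verts M n \<subseteq> set ?vs"
  proof
    fix v assume "v \<in> lexC_verts M n"
    then obtain i w where iw: "i < M" "v = pt n i w" by (rule lexC_vertsE)
    obtain e where e: "[?R * e = 1] (mod int n)" using cong_solve_coprime_int[OF cop] by blast
    define j where "j = nat ((e * (w - sum s {..<i})) mod int n)"
    have j: "j < n" using n by (simp add: j_def nat_less_iff)
    have "[int j * ?R = (e * (w - sum s {..<i})) * ?R] (mod int n)"
      using n by (simp add: j_def cong_def mod_simps)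
    also have "(e * (w - sum s {..<i})) * ?R = (?R * e) * (w - sum s {..<i})" by (simp add: algebra_simps)
    also have "[(?R * e) * (w - sum s {..<i}) = 1 * (w - sum s {..<i})] (mod int n)"
      using e by (rule cong_scalar_right)
    finally have "[int j * ?R + sum s {..<i} = 1 * (w - sum s {..<i}) + sum s {..<i}] (mod int n)"
      by (rule cong_add[OF _ cong_refl])
    then have "[w = int j * ?R + sum s {..<i}] (mod int n)" by (simp add: cong_sym_eq)
    from pt_in_strand[OF n iw(1) this] show "v \<in> set ?vs"
      using j iw(2) by auto
  qed
qed

section \<open>Twisted pairs of rows\<close>

text \<open>The twist alters only edges at layer 1; the rest of a row still falls into these
  \<open>n\<close> paths from layer 2 onward to layer 0.\<close>

definition return_path :: "nat \<Rightarrow> nat \<Rightarrow> (nat \<Rightarrow> int) \<Rightarrow> int \<Rightarrow> (nat \<times> nat) list" where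
  "return_path M n s z = map (\<lambda>i. pt n i (z + sum s {2..<i})) [2..<M] @ [pt n 0 (z + sum s {2..<M})]"

text \<open>Two rows with shifts {0, 1} from layer 0 to layer 1 and {0, -1} from layer 1 to layer 2 use, at a vertex u of
  layer 1, the vertices u - 1 and u on both sides. In the twisted redistribution one row uses k = u - 1 in layer 0
  and k = u in layer 2, except that it turns back at u = 0 and u = 1; the other row uses the remaining edges.\<close>

definition twist_lower :: "nat \<Rightarrow> int \<Rightarrow> int \<Rightarrow> bool" where
  "twist_lower n k u \<longleftrightarrow> [u \<noteq> 1] (mod int n) \<and> [k = u - 1] (mod int n) \<or>
     [u = 0] (mod int n) \<and> [k = 0] (mod int n)"

definition twist_upper :: "nat \<Rightarrow> int \<Rightarrow> int \<Rightarrow> bool" where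
  "twist_upper n k u \<longleftrightarrow> [u \<noteq> 0] (mod int n) \<and> [k = u] (mod int n) \<or>
     [u = 1] (mod int n) \<and> [k = 0] (mod int n)"

text \<open>\<open>P\<close> and \<open>Q\<close> take the vertex of layer 1 as second argument,
  hence the exchanged arguments for edges that leave layer 1.\<close>

definition twist_rel ::
  "nat \<Rightarrow> (int \<Rightarrow> int \<Rightarrow> bool) \<Rightarrow> (int \<Rightarrow> int \<Rightarrow> bool) \<Rightarrow> (nat \<Rightarrow> int) \<Rightarrow> nat \<Rightarrow> nat \<Rightarrow> nat \<Rightarrow> bool" where
  "twist_rel n P Q s i x y = (if i = 0 then P (int x) (int y)
     else if i = 1 then Q (int y) (int x) else shift_rel n s i x y)"

lemma twist_lower_mod: "n > 0 \<Longrightarrow> twist_lower n (int (nat (k mod int n))) (int (nat (u mod int n))) \<longleftrightarrow> twist_lower n k u"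
  by (simp add: twist_lower_def cong_def mod_simps)

lemma twist_upper_mod: "n > 0 \<Longrightarrow> twist_upper n (int (nat (k mod int n))) (int (nat (u mod int n))) \<longleftrightarrow> twist_upper n k u"
  by (simp add: twist_upper_def cong_def mod_simps)

lemma length_return_path [simp]: "M \<ge> 2 \<Longrightarrow> length (return_path M n s z) = M - 1"
  by (simp add: return_path_def)

lemma return_path_nonempty [simp]: "return_path M n s z \<noteq> []"
  by (simp add: return_path_def)

lemma hd_return_path: "M \<ge> 3 \<Longrightarrow> hd (return_path M n s z) = pt n 2 z"
  by (simp add: return_path_def hd_append hd_map)

lemma last_return_path: "last (return_path M n s z) = pt n 0 (z + sum s {2..<M})"
  by (simp add: return_path_def)

lemma return_path_successively:
  assumes "n > 0" "M \<ge> 3"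
  shows "successively (arc_step M n (twist_rel n P Q s)) (return_path M n s z)"
    and "successively (arc_step M n (twist_rel n P Q s)) (rev (return_path M n s z))"
proof -
  obtain m where m: "M = Suc m" "m \<ge> 2" using assms(2) by (cases M) auto
  have "successively (\<lambda>i j. arc_step M n (twist_rel n P Q s) (pt n i (z + sum s {2..<i})) (pt n j (z + sum s {2..<j}))) [2..<M]"
    by (rule successively_upt, rule arc_step_pt(1))
       (use assms in \<open>auto simp: twist_rel_def shift_rel_mod ac_simps\<close>)
  moreover have "arc_step M n (twist_rel n P Q s) (pt n m (z + sum s {2..<m})) (pt n 0 (z + sum s {2..<M}))"
    by (rule arc_step_pt(1)) (use assms m in \<open>auto simp: twist_rel_def shift_rel_mod ac_simps\<close>)
  ultimately show *: "successively (arc_step M n (twist_rel n P Q s)) (return_path M n s z)"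
    unfolding return_path_def successively_append_iff successively_map using m by simp
  show "successively (arc_step M n (twist_rel n P Q s)) (rev (return_path M n s z))"
    using successively_mono[OF *] arc_step_sym by simp
qed

lemma return_path_cong:
  assumes "[z = w] (mod int n)"
  shows "return_path M n s z = return_path M n s w"
proof -
  have "pt n i (z + a) = pt n i (w + a)" for i a
    using cong_add[OF assms cong_refl[of a]] by (simp add: pt_def cong_def)
  then show ?thesis by (simp add: return_path_def)
qed

lemma pt_in_return_path:
  assumes "i < M" "i \<noteq> 1"
  shows "\<exists>w. pt n i z \<in> set (return_path M n s w)"
proof (cases "i = 0")
  case True
  then have "pt n i z \<in> set (return_path M n s (z - sum s {2..<M}))" by (simp add: return_path_def)
  then show ?thesis ..
next
  case False
  then have "i \<in> {2..<M}" using assms by auto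
  then have "pt n i z \<in> set (return_path M n s (z - sum s {2..<i}))"
    by (auto simp: return_path_def intro!: image_eqI[of _ _ i])
  then show ?thesis ..
qed

text \<open>Vertices of layer 1 alternate with return paths. A path may be run in either direction,
  because the cycle reverses its sense whenever it turns back at layer 1.\<close>

lemma twisted_hamilton:
  assumes M: "M \<ge> 3" and n: "n \<ge> 2"
    and steps: "\<And>j. j < n \<Longrightarrow> successively (arc_step M n D) (pt n 1 (u j) # p j)"
    and link: "\<And>j. Suc j < n \<Longrightarrow> arc_step M n D (last (p j)) (pt n 1 (u (Suc j)))"
    and close: "arc_step M n D (last (p (n - 1))) (pt n 1 (u 0))"
    and p: "\<And>j. p j = return_path M n s (w j) \<or> p j = rev (return_path M n s (w j))"
    and u_surj: "\<And>z. \<exists>j<n. [z = u j] (mod int n)"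
    and w_surj: "\<And>z. \<exists>j<n. [z = w j] (mod int n)"
  shows "cycle_factorable M n (M * n) D"
proof (rule hamilton_factorable)
  let ?vs = "concat (map (\<lambda>j. pt n 1 (u j) # p j) [0..<n])"
  have ne: "p j \<noteq> []" for j using p[of j] by auto
  have "length (p j) = M - 1" for j using p[of j] M by auto
  then show "length ?vs = M * n" using M by (simp add: length_concat comp_def sum_list_triv)
  show "M * n \<ge> 3" using M n mult_le_mono[of 3 M 1 n] by simp
  show "successively (arc_step M n D) ?vs"
  proof (rule successively_concat)
    show "successively (\<lambda>xs ys. arc_step M n D (last xs) (hd ys)) (map (\<lambda>j. pt n 1 (u j) # p j) [0..<n])"
      unfolding successively_map by (rule successively_upt) (use link ne in auto)
  qed (use steps in auto)
  obtain m where m: "n = Suc m" using n by (cases n) auto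
  have "last ?vs = last (p (n - 1))" using ne by (simp add: m)
  moreover have "hd ?vs = pt n 1 (u 0)"
    by (simp add: m upt_conv_Cons del: upt_Suc)
  ultimately show "arc_step M n D (last ?vs) (hd ?vs)" using close by simp
  show "lexC_verts M n \<subseteq> set ?vs"
  proof
    fix v assume "v \<in> lexC_verts M n"
    then obtain i z where iz: "i < M" "v = pt n i z" by (rule lexC_vertsE)
    show "v \<in> set ?vs"
    proof (cases "i = 1")
      case True
      obtain j where "j < n" "[z = u j] (mod int n)" using u_surj by blast
      moreover from this have "v = pt n 1 (u j)" using iz True n by (simp add: pt_eq_iff)
      ultimately show ?thesis by auto
    next
      case False
      then obtain z' where z': "v \<in> set (return_path M n s z')" using pt_in_return_path iz by blast
      obtain j where j: "j < n" "[z' = w j] (mod int n)" using w_surj by blast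
      then have "v \<in> set (p j)" using z' return_path_cong[OF j(2)] p[of j] by auto
      then show ?thesis using j by auto
    qed
  qed
qed

lemma not_cong_between:
  fixes a b :: int
  assumes "a < b" "b < a + int n"
  shows "[a \<noteq> b] (mod int n)" "[b \<noteq> a] (mod int n)"
proof -
  show "[b \<noteq> a] (mod int n)"
    using assms zdvd_imp_le[of "int n" "b - a"] by (auto simp: cong_iff_dvd_diff)
  then show "[a \<noteq> b] (mod int n)" by (simp add: cong_sym_eq)
qed

lemma not_cong_parity:
  fixes a b :: int
  assumes "even n" "odd (a - b)"
  shows "[a \<noteq> b] (mod int n)"
proof
  assume "[a = b] (mod int n)"
  then have "int n dvd a - b" by (simp add: cong_iff_dvd_diff)
  moreover have "2 dvd int n" using assms(1) by simp
  ultimately show False using assms(2) dvd_trans by blast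
qed

lemma arc_step_twist:
  assumes "n > 0" "M \<ge> 3"
    and P: "\<And>k u. P (int (nat (k mod int n))) (int (nat (u mod int n))) \<longleftrightarrow> P k u"
    and Q: "\<And>k u. Q (int (nat (k mod int n))) (int (nat (u mod int n))) \<longleftrightarrow> Q k u"
  shows "P k u \<Longrightarrow> arc_step M n (twist_rel n P Q s) (pt n 0 k) (pt n 1 u)"
    and "Q k u \<Longrightarrow> arc_step M n (twist_rel n P Q s) (pt n 1 u) (pt n 2 k)"
proof -
  show "arc_step M n (twist_rel n P Q s) (pt n 0 k) (pt n 1 u)" if "P k u"
    by (rule arc_step_pt(1)) (use assms that in \<open>simp_all add: twist_rel_def\<close>)
  show "arc_step M n (twist_rel n P Q s) (pt n 1 u) (pt n 2 k)" if "Q k u"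
    by (rule arc_step_pt(1)) (use assms that in \<open>simp_all add: twist_rel_def\<close>)
qed

text \<open>Return paths lead from \<open>z\<close> to \<open>z\<close>, so an ordinary turn moves
  \<open>u\<close> to \<open>u + 1\<close> in layer 1. The cycle leaves 0 towards layer 0, runs path
  0 backwards, enters 1 from layer 2, and continues forwards through 2, 3 and so on back to
  0.\<close>

lemma twist_factorable_lower:
  assumes M: "M \<ge> 3" and n: "n \<ge> 2" and sum: "[sum s {2..<M} = 0] (mod int n)"
  shows "cycle_factorable M n (M * n) (twist_rel n (twist_lower n) (twist_upper n) s)"
proof -
  let ?D = "twist_rel n (twist_lower n) (twist_upper n) s"
  define p where "p j = (if j = 0 then rev (return_path M n s 0) else return_path M n s (int j))" for j :: nat
  have n0: "n > 0" using n by simp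
  have last: "last (return_path M n s z) = pt n 0 z" for z
    using cong_add[OF cong_refl sum, of z] n0 by (simp add: last_return_path pt_eq_iff)
  have s0: "arc_step M n ?D (pt n 0 k) (pt n 1 u)" "arc_step M n ?D (pt n 1 u) (pt n 0 k)"
    if "twist_lower n k u" for k u
    using arc_step_twist(1)[where P = "twist_lower n" and Q = "twist_upper n", OF n0 M twist_lower_mod[OF n0] twist_upper_mod[OF n0] that] arc_step_sym by blast+
  have s1: "arc_step M n ?D (pt n 2 k) (pt n 1 u)" "arc_step M n ?D (pt n 1 u) (pt n 2 k)"
    if "twist_upper n k u" for k u
    using arc_step_twist(2)[where P = "twist_lower n" and Q = "twist_upper n", OF n0 M twist_lower_mod[OF n0] twist_upper_mod[OF n0] that] arc_step_sym by blast+
  note pdefs = p_def hd_rev last_rev hd_return_path[OF M] last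
  show ?thesis
  proof (rule twisted_hamilton[OF M n, where u = int and p = p and w = int and s = s])
    fix j assume j: "j < n"
    have "arc_step M n ?D (pt n 1 (int j)) (hd (p j))"
    proof (cases "j = 0")
      case True
      have "twist_lower n 0 0" by (simp add: twist_lower_def)
      from s0(2)[OF this] True show ?thesis by (simp add: pdefs)
    next
      case False
      then have "[int j \<noteq> 0] (mod int n)" using j by (intro not_cong_between) auto
      then have "twist_upper n (int j) (int j)" by (simp add: twist_upper_def)
      from s1(2)[OF this] False show ?thesis by (simp add: pdefs)
    qed
    then show "successively (arc_step M n ?D) (pt n 1 (int j) # p j)"
      using return_path_successively[OF n0 M, of "twist_lower n" "twist_upper n" s]
      by (simp add: successively_Cons p_def)
  next
    fix j assume j: "Suc j < n"
    show "arc_step M n ?D (last (p j)) (pt n 1 (int (Suc j)))"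
    proof (cases "j = 0")
      case True
      have "twist_upper n 0 1" by (simp add: twist_upper_def)
      from s1(1)[OF this] True show ?thesis by (simp add: pdefs)
    next
      case False
      then have "[int (Suc j) \<noteq> 1] (mod int n)" using j by (intro not_cong_between) auto
      then have "twist_lower n (int j) (int (Suc j))" by (simp add: twist_lower_def)
      from s0(1)[OF this] False show ?thesis by (simp add: pdefs)
    qed
  next
    have "[0 \<noteq> 1] (mod int n)" using n by (intro not_cong_between) auto
    moreover have "[int (n - 1) = - 1] (mod int n)" using n by (simp add: cong_iff_dvd_diff of_nat_diff)
    ultimately have "twist_lower n (int (n - 1)) 0" by (simp add: twist_lower_def)
    from s0(1)[OF this] show "arc_step M n ?D (last (p (n - 1))) (pt n 1 (int 0))"
      using n by (simp add: pdefs)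
  next
    fix z :: int
    show "\<exists>j<n. [z = int j] (mod int n)"
      using n0 by (intro exI[of _ "nat (z mod int n)"]) (auto simp: nat_less_iff cong_def)
    then show "\<exists>j<n. [z = int j] (mod int n)" .
  qed (auto simp: p_def)
qed

text \<open>The cycle visits the vertices 1, 3, \<open>\<dots>\<close>, n - 1, 0, n - 2, n - 4, \<open>\<dots>\<close>, 2 of layer 1 in this order; it follows the
  return paths backwards during the first half.\<close>

lemma twist_factorable_upper:
  assumes M: "M \<ge> 3" and n: "n \<ge> 2" "even n" and sum: "[sum s {2..<M} = - 1] (mod int n)"
  shows "cycle_factorable M n (M * n) (twist_rel n (twist_upper n) (twist_lower n) s)"
proof -
  let ?D = "twist_rel n (twist_upper n) (twist_lower n) s"
  obtain m where m: "n = 2 * m" using n(2) by blast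
  \<comment> \<open>Return paths now lead from \<open>z\<close> to \<open>z - 1\<close>, so an
    ordinary turn moves \<open>u\<close> by -2, or by 2 if run backwards. For even \<open>n\<close>
    this separates odd from even vertices; the turning points 1 and 0 join the two classes. Values
    stay unreduced modulo \<open>n\<close>, hence the negative second half.\<close>
  define u where "u j = (if j < m then 2 * int j + 1 else - 2 * int j)" for j :: nat
  define w where "w j = (if j < m then 2 * int j + 2 else - 2 * int j - 1)" for j :: nat
  define p where "p j = (if j < m then rev (return_path M n s (w j)) else return_path M n s (w j))" for j :: nat
  have n0: "n > 0" and m0: "m > 0" using n m by auto
  have last: "last (return_path M n s z) = pt n 0 (z - 1)" for z
    using cong_add[OF cong_refl sum, of z] n0 by (simp add: last_return_path pt_eq_iff)
  have s0: "arc_step M n ?D (pt n 0 k) (pt n 1 u)" "arc_step M n ?D (pt n 1 u) (pt n 0 k)"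
    if "twist_upper n k u" for k u
    using arc_step_twist(1)[where P = "twist_upper n" and Q = "twist_lower n", OF n0 M twist_upper_mod[OF n0] twist_lower_mod[OF n0] that] arc_step_sym by blast+
  have s1: "arc_step M n ?D (pt n 2 k) (pt n 1 u)" "arc_step M n ?D (pt n 1 u) (pt n 2 k)"
    if "twist_lower n k u" for k u
    using arc_step_twist(2)[where P = "twist_upper n" and Q = "twist_lower n", OF n0 M twist_upper_mod[OF n0] twist_lower_mod[OF n0] that] arc_step_sym by blast+
  have hdp: "hd (p j) = (if j < m then pt n 0 (w j - 1) else pt n 2 (w j))" for j
    by (simp add: p_def hd_rev hd_return_path[OF M] last)
  have lastp: "last (p j) = (if j < m then pt n 2 (w j) else pt n 0 (w j - 1))" for j
    by (simp add: p_def last_rev hd_return_path[OF M] last)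
  show ?thesis
  proof (rule twisted_hamilton[OF M n(1), where u = u and p = p and w = w and s = s])
    fix j assume j: "j < n"
    have "arc_step M n ?D (pt n 1 (u j)) (hd (p j))"
    proof (cases "j < m")
      case True
      have "[u j \<noteq> 0] (mod int n)" using n True by (intro not_cong_parity) (auto simp: u_def)
      moreover have "w j - 1 = u j" using True by (simp add: u_def w_def)
      ultimately have "twist_upper n (w j - 1) (u j)" by (simp add: twist_upper_def)
      from s0(2)[OF this] True show ?thesis by (simp add: hdp)
    next
      case False
      have "[u j \<noteq> 1] (mod int n)" using n False by (intro not_cong_parity) (auto simp: u_def)
      moreover have "w j = u j - 1" using False by (simp add: u_def w_def)
      ultimately have "twist_lower n (w j) (u j)" by (simp add: twist_lower_def)
      from s1(2)[OF this] False show ?thesis by (simp add: hdp)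
    qed
    then show "successively (arc_step M n ?D) (pt n 1 (u j) # p j)"
      using return_path_successively[OF n0 M, of "twist_upper n" "twist_lower n" s]
      by (simp add: successively_Cons p_def)
  next
    fix j assume j: "Suc j < n"
    consider "Suc j < m" | "Suc j = m" | "j \<ge> m" by linarith
    then show "arc_step M n ?D (last (p j)) (pt n 1 (u (Suc j)))"
    proof cases
      case 1
      then have "[u (Suc j) \<noteq> 1] (mod int n)" using j m by (intro not_cong_between) (auto simp: u_def)
      moreover have "w j = u (Suc j) - 1" using 1 by (simp add: u_def w_def)
      ultimately have "twist_lower n (w j) (u (Suc j))" by (simp add: twist_lower_def)
      from s1(1)[OF this] 1 show ?thesis by (simp add: lastp)
    next
      case 2
      \<comment> \<open>Passage from the odd to the even vertices: the path ends at residue 0 of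
        layer 2, and the second clause of \<open>twist_lower\<close> joins this to 0 in layer
        1.\<close>
      have "w j = int n" using 2 m by (auto simp: w_def)
      moreover have "u (Suc j) = - int n" using 2 m by (auto simp: u_def)
      ultimately have "twist_lower n (w j) (u (Suc j))" by (simp add: twist_lower_def cong_iff_dvd_diff)
      from s1(1)[OF this] 2 show ?thesis by (simp add: lastp)
    next
      case 3
      \<comment> \<open>The multiple of \<open>n\<close> moves the unreduced value strictly between
        0 and \<open>n\<close>.\<close>
      have "[u (Suc j) + 2 * int n \<noteq> 0] (mod int n)"
        using j 3 m by (intro not_cong_between) (auto simp: u_def)
      moreover have "u (Suc j) + 2 * int n - 0 = u (Suc j) + int n * 2" by simp
      ultimately have "[u (Suc j) \<noteq> 0] (mod int n)"
        by (metis cong_add_lcancel_0 cong_iff_dvd_diff cong_trans diff_zero dvd_add_left_iff dvd_triv_left)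
      moreover have "w j - 1 = u (Suc j)" using 3 by (simp add: u_def w_def)
      ultimately have "twist_upper n (w j - 1) (u (Suc j))" by (simp add: twist_upper_def)
      from s0(1)[OF this] 3 show ?thesis by (simp add: lastp)
    qed
  next
    have nm: "\<not> n - 1 < m" using m n by auto
    then have "w (n - 1) - 1 = - 2 * int n" using n by (simp add: w_def of_nat_diff)
    moreover have "u 0 = 1" using m0 by (simp add: u_def)
    ultimately have "twist_upper n (w (n - 1) - 1) (u 0)" by (simp add: twist_upper_def cong_iff_dvd_diff)
    from s0(1)[OF this] show "arc_step M n ?D (last (p (n - 1))) (pt n 1 (u 0))"
      using nm by (simp add: lastp)
  next
    fix z :: int
    define r where "r = z mod int n"
    have r: "0 \<le> r" "r < int n" "[z = r] (mod int n)" using n0 by (auto simp: r_def cong_def)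
    consider k where "r = 2 * k + 1" | "r = 0" | k where "r = 2 * k" "k > 0"
      using r(1) by (metis evenE oddE linorder_neqE_linordered_idom mult_less_0_iff not_less zero_less_numeral
        mult_zero_right)
    then show "\<exists>j<n. [z = u j] (mod int n)"
    proof cases
      case 1
      then have "nat k < m" "u (nat k) = r" using r m by (auto simp: u_def)
      then show ?thesis using r(3) m by (intro exI[of _ "nat k"]) auto
    next
      case 2
      have "[z = u m] (mod int n)"
        using r(3) 2 m cong_trans[of z 0 "int n" "u m"] by (simp add: u_def cong_iff_dvd_diff)
      then show ?thesis using m m0 by (intro exI[of _ m]) auto
    next
      case 3
      define j where "j = n - nat k"
      have j: "j < n" "\<not> j < m" "int j = int n - k" using 3 r m by (auto simp: j_def)
      then have "u j = r - 2 * int n" using 3 by (simp add: u_def)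
      then have "[r = u j] (mod int n)" by (simp add: cong_iff_dvd_diff)
      then show ?thesis using j r(3) cong_trans by blast
    qed
    from r consider k where "r = 2 * k + 1" | "r = 0" | k where "r = 2 * k" "k > 0"
      by (metis evenE oddE linorder_neqE_linordered_idom mult_less_0_iff not_less zero_less_numeral
        mult_zero_right)
    then show "\<exists>j<n. [z = w j] (mod int n)"
    proof cases
      case 1
      define j where "j = n - nat (k + 1)"
      have j: "j < n" "\<not> j < m" "int j = int n - (k + 1)" using 1 r m by (auto simp: j_def)
      then have "w j = r - 2 * int n" using 1 by (simp add: w_def)
      then have "[r = w j] (mod int n)" by (simp add: cong_iff_dvd_diff)
      then show ?thesis using j r(3) cong_trans by blast
    next
      case 2
      have "w (m - 1) = int n" using m m0 by (auto simp: w_def of_nat_diff)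
      then have "[r = w (m - 1)] (mod int n)" using 2 by (simp add: cong_iff_dvd_diff)
      then show ?thesis using m m0 r(3) cong_trans by (intro exI[of _ "m - 1"]) auto
    next
      case 3
      define j where "j = nat k - 1"
      have "j < m" "w j = r" using 3 r m by (auto simp: j_def w_def of_nat_diff)
      then show ?thesis using m r(3) by (intro exI[of _ j]) auto
    qed
  qed (auto simp: p_def)
qed

lemma twist_lower_upper_disjoint:
  assumes "n \<ge> 2" "twist_lower n k u" "twist_upper n k u"
  shows False
proof -
  have "[0 \<noteq> 1] (mod int n)" using assms(1) by (intro not_cong_between) auto
  moreover have "[0 = 1] (mod int n)"
  proof -
    have "[u = 0] (mod int n) \<and> [u = 1] (mod int n) \<or> [u - 1 = u] (mod int n)"
      using assms(2,3) unfolding twist_lower_def twist_upper_def by (metis cong_trans cong_sym)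
    then show ?thesis
    proof
      assume "[u - 1 = u] (mod int n)"
      then have "[(u - 1) + (1 - u) = u + (1 - u)] (mod int n)" by (rule cong_add) simp
      then show ?thesis by simp
    qed (metis cong_trans cong_sym)
  qed
  ultimately show False by simp
qed

text \<open>A twist only redistributes: each edge at layer 1 still has one of the two original
  shifts, which keeps the pair disjoint from all other rows.\<close>

lemma twist_cong:
  assumes "twist_lower n k u \<or> twist_upper n k u"
  shows "[u = k] (mod int n) \<or> [u = k + 1] (mod int n)"
proof -
  have 1: "[u = k + 1] (mod int n)" if "[k = u - 1] (mod int n)"
    using cong_add[OF that cong_refl[of 1]] by (simp add: cong_sym_eq)
  have 2: "[u = k] (mod int n)" if "[u = 0] (mod int n)" "[k = 0] (mod int n)"
    using that by (metis cong_sym cong_trans)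
  have 3: "[u = k + 1] (mod int n)" if "[u = 1] (mod int n)" "[k = 0] (mod int n)"
    using that cong_add[OF that(2) cong_refl[of 1]] by (simp, metis cong_sym cong_trans)
  show ?thesis using assms 1 2 3 unfolding twist_lower_def twist_upper_def by (metis cong_sym)
qed

section \<open>From matrices of shifts to decompositions\<close>

definition extend_columns :: "(nat \<Rightarrow> int) list \<Rightarrow> nat \<Rightarrow> nat \<Rightarrow> int" where
  "extend_columns cs i v = (if i < length cs then (cs ! i) v else if even i then int v else - int v)"

text \<open>Neighbouring added columns have opposite signs whatever the parity of
  \<open>length cs\<close>, so they cancel in pairs. The start \<open>a\<close> will be 0 for whole
  rows and 2 for the part behind a twist.\<close>

lemma sum_extend_columns:
  assumes "M = length cs + 2 * k" "a \<le> length cs"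
  shows "(\<Sum>i\<in>{a..<M}. extend_columns cs i v) = (\<Sum>f\<leftarrow>drop a cs. f v)"
  using assms
proof (induction k arbitrary: M)
  case 0
  have "(\<Sum>f\<leftarrow>drop a cs. f v) = (\<Sum>i=0..<length cs - a. (cs ! (a + i)) v)"
    by (simp add: sum_list_sum_nth)
  also have "\<dots> = (\<Sum>i\<in>{a..<length cs}. (cs ! i) v)"
    by (rule sum.reindex_bij_witness[of _ "\<lambda>i. i - a" "\<lambda>i. a + i"]) auto
  finally show ?case using 0 by (simp add: extend_columns_def)
next
  case (Suc k)
  define M' where "M' = length cs + 2 * k"
  have "M = Suc (Suc M')" using Suc.prems by (simp add: M'_def)
  moreover have "a \<le> M'" using Suc.prems by (simp add: M'_def)
  moreover have "extend_columns cs M' v + extend_columns cs (Suc M') v = 0"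
    by (simp add: extend_columns_def M'_def)
  ultimately show ?case using Suc.IH[OF M'_def Suc.prems(2)] by simp
qed

lemma inj_on_mod_column:
  fixes f :: "nat \<Rightarrow> nat"
  assumes "inj_on f {..<n}" "\<And>v. v < n \<Longrightarrow> f v < n"
  shows "inj_on (\<lambda>v. (int (f v) + c) mod int n) {..<n}" "inj_on (\<lambda>v. (c - int (f v)) mod int n) {..<n}"
proof -
  have eq: "v = w" if "v < n" "w < n" "[int (f v) = int (f w)] (mod int n)" for v w
    using that assms by (auto simp: cong_def inj_on_def)
  show "inj_on (\<lambda>v. (int (f v) + c) mod int n) {..<n}"
    by (rule inj_onI, rule eq) (auto simp: cong_add_rcancel simp flip: cong_def)
  show "inj_on (\<lambda>v. (c - int (f v)) mod int n) {..<n}"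
  proof (rule inj_onI, rule eq)
    fix v w assume "(c - int (f v)) mod int n = (c - int (f w)) mod int n"
    then have "[c - int (f v) = c - int (f w)] (mod int n)" by (simp add: cong_def)
    from cong_diff[OF cong_refl[of c] this] show "[int (f v) = int (f w)] (mod int n)" by simp
  qed auto
qed

lemma inj_on_extend_columns:
  assumes "\<And>f. f \<in> set cs \<Longrightarrow> inj_on (\<lambda>v. f v mod int n) {..<n}"
  shows "inj_on (\<lambda>v. extend_columns cs i v mod int n) {..<n}"
proof (cases "i < length cs")
  case False
  then show ?thesis
    using inj_on_mod_column[of "\<lambda>v. v" n 0] by (cases "even i") (auto simp: extend_columns_def)
qed (use assms[of "cs ! i"] in \<open>simp add: extend_columns_def\<close>)

lemma shift_rel_inj:
  assumes "inj_on (\<lambda>v. s i v mod int n) {..<n}" "t < n" "t' < n"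
    and "[int z = int x + s i t] (mod int n)" "[int z = int x + s i t'] (mod int n)"
  shows "t = t'"
proof -
  have "[int x + s i t = int x + s i t'] (mod int n)" using assms(4,5) by (metis cong_sym cong_trans)
  then have "s i t mod int n = s i t' mod int n" by (simp add: cong_add_lcancel) (simp add: cong_def)
  then show ?thesis using assms(1-3) by (auto simp: inj_on_def)
qed

lemma cyclic_HWP:
  assumes M: "M \<ge> 3" "M = length cs + 2 * k" and n: "n \<ge> 2" and H: "H \<subseteq> {..<n}" "card H = y"
    and inj: "\<And>f. f \<in> set cs \<Longrightarrow> inj_on (\<lambda>v. f v mod int n) {..<n}"
    and cop: "\<And>v. v \<in> H \<Longrightarrow> coprime (\<Sum>f\<leftarrow>cs. f v) (int n)"
    and zero: "\<And>v. v < n \<Longrightarrow> v \<notin> H \<Longrightarrow> [(\<Sum>f\<leftarrow>cs. f v) = 0] (mod int n)"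
  shows "(n - y, y) \<in> HWP (lexC_verts M n) (lexC_edges M n) M (M * n)"
proof (rule HWP_intro[OF M(1) H, where D = "\<lambda>t. shift_rel n (\<lambda>i. extend_columns cs i t)"])
  have sum: "(\<Sum>i<M. extend_columns cs i t) = (\<Sum>f\<leftarrow>cs. f t)" for t
    using sum_extend_columns[OF M(2), of 0 t] by (simp add: lessThan_atLeast0)
  fix t assume "t < n"
  then show "cycle_factorable M n (if t \<in> H then M * n else M) (shift_rel n (\<lambda>i. extend_columns cs i t))"
    using shift_factorable_zero[OF M(1)] shift_factorable_coprime[OF M(1)] cop zero n
    by (simp add: sum)
next
  fix t t' i x z
  assume *: "t < n" "t' < n" "shift_rel n (\<lambda>i. extend_columns cs i t) i x z"
    "shift_rel n (\<lambda>i. extend_columns cs i t') i x z"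
  show "t = t'"
    by (rule shift_rel_inj[of "extend_columns cs" i, OF inj_on_extend_columns[OF inj]])
       (use * in \<open>auto simp: shift_rel_def\<close>)
qed

text \<open>Rows \<open>a\<close> and \<open>b\<close> begin with the shifts 0, 0 and 1, -1 whose
  edges the twist redistributes. Their remaining sums 0 and -1 are those that
  \<open>twist_factorable_lower\<close> and \<open>twist_factorable_upper\<close> require.\<close>

lemma cyclic_HWP_twisted:
  assumes M: "M \<ge> 3" "M = length (f # g # cs) + 2 * k" and n: "n \<ge> 2" "even n" and H: "H \<subseteq> {..<n}" "card H = y"
    and inj: "\<And>h. h \<in> set (f # g # cs) \<Longrightarrow> inj_on (\<lambda>v. h v mod int n) {..<n}"
    and a: "a \<in> H" "[f a = 0] (mod int n)" "[g a = 0] (mod int n)" "[(\<Sum>h\<leftarrow>cs. h a) = 0] (mod int n)"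
    and b: "b \<in> H" "[f b = 1] (mod int n)" "[g b = - 1] (mod int n)" "[(\<Sum>h\<leftarrow>cs. h b) = - 1] (mod int n)"
    and cop: "\<And>v. v \<in> H \<Longrightarrow> v \<noteq> a \<Longrightarrow> v \<noteq> b \<Longrightarrow> coprime (f v + g v + (\<Sum>h\<leftarrow>cs. h v)) (int n)"
    and zero: "\<And>v. v < n \<Longrightarrow> v \<notin> H \<Longrightarrow> [f v + g v + (\<Sum>h\<leftarrow>cs. h v) = 0] (mod int n)"
  shows "(n - y, y) \<in> HWP (lexC_verts M n) (lexC_edges M n) M (M * n)"
proof -
  define s where "s = extend_columns (f # g # cs)"
  define D where "D t = (if t = a then twist_rel n (twist_lower n) (twist_upper n) (\<lambda>i. s i t)
    else if t = b then twist_rel n (twist_upper n) (twist_lower n) (\<lambda>i. s i t)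
    else shift_rel n (\<lambda>i. s i t))" for t
  have inj': "inj_on (\<lambda>v. s i v mod int n) {..<n}" for i
    unfolding s_def by (rule inj_on_extend_columns[OF inj])
  have ab: "a < n" "b < n" using a(1) b(1) H by auto
  have s01: "s 0 = f" "s 1 = g" by (auto simp: s_def extend_columns_def)
  have sum2: "(\<Sum>i\<in>{2..<M}. s i t) = (\<Sum>h\<leftarrow>cs. h t)" for t
    using sum_extend_columns[OF M(2), of 2 t] by (simp add: s_def numeral_2_eq_2)
  have sum0: "(\<Sum>i<M. s i t) = f t + g t + (\<Sum>h\<leftarrow>cs. h t)" for t
    using sum_extend_columns[OF M(2), of 0 t] by (simp add: s_def lessThan_atLeast0)
  have n01: "[0 \<noteq> 1] (mod int n)" using n by (intro not_cong_between) auto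
  have neab: "a \<noteq> b"
  proof
    assume "a = b"
    then have "[0 = 1] (mod int n)" using a(2) b(2) cong_trans cong_sym by blast
    then show False using n01 by simp
  qed
  have Dgen: "[int z = int x + s i t] (mod int n)"
    if "D t i x z" "i \<ge> 2 \<or> t \<noteq> a \<and> t \<noteq> b" for t i x z
    using that by (auto simp: D_def twist_rel_def shift_rel_def split: if_splits)
  have D01: "[int z = int x + s i a] (mod int n) \<or> [int z = int x + s i b] (mod int n)"
    if "D t i x z" "i < 2" "t = a \<or> t = b" for t i x z
  proof (cases "i = 0")
    case True
    then have "twist_lower n (int x) (int z) \<or> twist_upper n (int x) (int z)"
      using that by (auto simp: D_def twist_rel_def split: if_splits)
    then have "[int z = int x] (mod int n) \<or> [int z = int x + 1] (mod int n)" by (rule twist_cong)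
    moreover have "[int x = int x + f a] (mod int n)" "[int x + 1 = int x + f b] (mod int n)"
      using cong_add[OF cong_refl cong_sym[OF a(2)], of "int x"] cong_add[OF cong_refl cong_sym[OF b(2)], of "int x"] by auto
    ultimately show ?thesis unfolding True s01 by (metis cong_trans)
  next
    case False
    then have i: "i = 1" using that by auto
    then have "twist_lower n (int z) (int x) \<or> twist_upper n (int z) (int x)"
      using that by (auto simp: D_def twist_rel_def split: if_splits)
    then have "[int x = int z] (mod int n) \<or> [int x = int z + 1] (mod int n)" by (rule twist_cong)
    then have "[int z = int x] (mod int n) \<or> [int z = int x + (- 1)] (mod int n)"
      using cong_add[of "int x" "int z + 1" "int n" "-1" "-1"] by (auto simp: cong_sym_eq)
    moreover have "[int x = int x + g a] (mod int n)" "[int x + (- 1) = int x + g b] (mod int n)"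
      using cong_add[OF cong_refl cong_sym[OF a(3)], of "int x"] cong_add[OF cong_refl cong_sym[OF b(3)], of "int x"] by auto
    ultimately show ?thesis unfolding i s01 by (metis cong_trans)
  qed
  show ?thesis
  proof (rule HWP_intro[OF M(1) H, where D = D])
    fix t assume t: "t < n"
    consider "t = a" | "t = b" | "t \<noteq> a" "t \<noteq> b" by blast
    then show "cycle_factorable M n (if t \<in> H then M * n else M) (D t)"
    proof cases
      case 1
      then show ?thesis using twist_factorable_lower[OF M(1) n(1), of "\<lambda>i. s i a"] a by (simp add: D_def sum2)
    next
      case 2
      then show ?thesis using twist_factorable_upper[OF M(1) n, of "\<lambda>i. s i b"] b neab by (simp add: D_def sum2)
    next
      case 3
      then show ?thesis
        using shift_factorable_zero[OF M(1)] shift_factorable_coprime[OF M(1)] cop zero n t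
        by (simp add: D_def sum0)
    qed
  next
    fix t t' i x z
    assume t: "t < n" "t' < n" and D: "D t i x z" "D t' i x z"
    have mixed: "t = t'" if "t < n" "D t i x z" "D t' i x z" "i < 2" "t' = a \<or> t' = b" "t \<noteq> a \<and> t \<noteq> b" for t t'
      using Dgen[OF that(2)] D01[OF that(3,4,5)] that(6) shift_rel_inj[of s i, OF inj' that(1) ab(1)]
        shift_rel_inj[of s i, OF inj' that(1) ab(2)] by blast
    consider "i \<ge> 2 \<or> (t \<noteq> a \<and> t \<noteq> b) \<and> (t' \<noteq> a \<and> t' \<noteq> b)" | "i < 2" "t = a \<or> t = b" "t' = a \<or> t' = b"
      | "i < 2" "t' = a \<or> t' = b" "t \<noteq> a \<and> t \<noteq> b" | "i < 2" "t = a \<or> t = b" "t' \<noteq> a \<and> t' \<noteq> b"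
      by linarith
    then show "t = t'"
    proof cases
      case 1
      then show ?thesis using Dgen[OF D(1)] Dgen[OF D(2)] shift_rel_inj[of s i, OF inj' t] by blast
    next
      case 2
      then show ?thesis
        using D twist_lower_upper_disjoint[OF n(1)]
        by (auto simp: D_def twist_rel_def split: if_splits)
    next
      case 3 then show ?thesis using mixed[OF t(1) D] by blast
    next
      case 4 then show ?thesis using mixed[OF t(2) D(2,1)] by metis
    qed
  qed
qed

section \<open>Permutations of rows made of transpositions\<close>

definition swaps :: "nat \<Rightarrow> nat \<Rightarrow> nat \<Rightarrow> nat" where
  "swaps a w v = (if a \<le> v \<and> v < a + 2 * w then (if even (v - a) then v + 1 else v - 1) else v)"

lemma swaps_outside: "v < a \<or> a + 2 * w \<le> v \<Longrightarrow> swaps a w v = v"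
  by (auto simp: swaps_def)

lemma swaps_inside:
  assumes "a \<le> v" "v < a + 2 * w"
  shows "a \<le> swaps a w v \<and> swaps a w v < a + 2 * w \<and> (int v - int (swaps a w v) = 1 \<or> int v - int (swaps a w v) = - 1)"
proof (cases "even (v - a)")
  case True
  then obtain j where "v - a = 2 * j" by blast
  then have "v = a + 2 * j" using assms by simp
  then show ?thesis using assms True by (auto simp: swaps_def)
next
  case False
  then obtain j where "v - a = 2 * j + 1" by (rule oddE)
  then have "v = a + 2 * j + 1" using assms by simp
  then show ?thesis using assms by (auto simp: swaps_def)
qed

lemma inj_swaps: "inj (swaps a w)"
proof (rule injI)
  have inv: "swaps a w (swaps a w v) = v" for v
  proof (cases "a \<le> v \<and> v < a + 2 * w")
    case True
    show ?thesis
    proof (cases "even (v - a)")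
      case ev: True
      then obtain j where "v - a = 2 * j" by blast
      then have "v = a + 2 * j" using True by linarith
      then show ?thesis using True by (auto simp: swaps_def)
    next
      case False
      then obtain j where "v - a = 2 * j + 1" by (rule oddE)
      then have "v = a + 2 * j + 1" using True by linarith
      then show ?thesis using True by (auto simp: swaps_def)
    qed
  qed (auto simp: swaps_def)
  fix v v' assume "swaps a w v = swaps a w v'" then show "v = v'" using inv by metis
qed

text \<open>A small core \<open>A\<close> with a handmade permutation \<open>f\<close> settles the
  parity; \<open>w\<close> transpositions then add \<open>2 * w\<close> rows with difference 1 or
  -1, so one core serves all larger \<open>y\<close> of its parity.\<close>

definition perm_swaps :: "nat set \<Rightarrow> (nat \<Rightarrow> nat) \<Rightarrow> nat \<Rightarrow> nat \<Rightarrow> nat \<Rightarrow> nat" where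
  "perm_swaps A f a w v = (if v \<in> A then f v else swaps a w v)"

lemma perm_swaps_inj:
  assumes "inj_on f A" "f ` A \<subseteq> A" "A \<inter> {a..<a + 2 * w} = {}" "a + 2 * w \<le> n" "A \<subseteq> {..<n}"
  shows "inj_on (perm_swaps A f a w) {..<n}" "\<And>v. v < n \<Longrightarrow> perm_swaps A f a w v < n"
proof -
  have out: "swaps a w v \<notin> A" if "v \<notin> A" for v
    using swaps_inside[of a v w] swaps_outside[of v a w] that assms(3) by (cases "a \<le> v \<and> v < a + 2 * w") auto
  show "inj_on (perm_swaps A f a w) {..<n}"
  proof (rule inj_onI)
    fix v v' assume eq: "perm_swaps A f a w v = perm_swaps A f a w v'"
    show "v = v'"
    proof (cases "v \<in> A \<longleftrightarrow> v' \<in> A")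
      case True
      then show ?thesis using eq assms(1) inj_swaps[of a w] by (auto simp: perm_swaps_def inj_on_def split: if_splits)
    next
      case False
      have mem: "perm_swaps A f a w u \<in> A \<longleftrightarrow> u \<in> A" for u
        using assms(2) out[of u] by (auto simp: perm_swaps_def)
      then show ?thesis using False eq mem[of v] mem[of v'] by simp
    qed
  qed
  fix v assume "v < n"
  then show "perm_swaps A f a w v < n"
    using assms(2,4,5) swaps_inside[of a v w] swaps_outside[of v a w]
    by (cases "a \<le> v \<and> v < a + 2 * w") (auto simp: perm_swaps_def)
qed

lemma perm_swaps_diff:
  "v \<notin> A \<Longrightarrow> a \<le> v \<Longrightarrow> v < a + 2 * w \<Longrightarrow>
     int v - int (perm_swaps A f a w v) = 1 \<or> int v - int (perm_swaps A f a w v) = - 1"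
  "v \<notin> A \<Longrightarrow> v < a \<or> a + 2 * w \<le> v \<Longrightarrow> perm_swaps A f a w v = v"
  using swaps_inside[of a v w] swaps_outside[of v a w] by (auto simp: perm_swaps_def)

text \<open>\<open>gcd x N\<close> divides \<open>2 * x - k * N\<close>, hence 4, and it is odd.
  This settles row sums near a multiple of \<open>m\<close>, such as \<open>3 * m - 1\<close>,
  modulo \<open>N = 2 * m\<close>.\<close>

lemma coprime_near:
  fixes x N :: int
  assumes "odd x" "2 * x = k * N + z" "z dvd 4"
  shows "coprime x N"
proof -
  have "gcd x N dvd 2 * x - k * N" by (intro dvd_diff dvd_mult) auto
  then have "gcd x N dvd 4" using assms(2,3) dvd_trans by auto
  moreover have "coprime x 4" using assms(1) coprime_power_right_iff[of x 2 2] by simp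
  ultimately have "is_unit (gcd x N)" by (meson coprime_def gcd_dvd1)
  then show ?thesis by (simp add: coprime_iff_gcd_eq_1)
qed

section \<open>The matrices\<close>

abbreviation (input) hwp_lexC :: "nat \<Rightarrow> nat \<Rightarrow> nat \<Rightarrow> bool" where
  "hwp_lexC M n y \<equiv> (n - y, y) \<in> HWP (lexC_verts M n) (lexC_edges M n) M (M * n)"

lemma odd_ge3E:
  assumes "odd M" "M \<ge> (3::nat)" obtains k where "M = 3 + 2 * k"
proof -
  obtain j where "M = 2 * j + 1" using assms(1) by (rule oddE)
  then have "M = 3 + 2 * (j - 1)" using assms(2) by auto
  then show ?thesis by (rule that)
qed

text \<open>Row \<open>v\<close> sums to \<open>v - \<pi> v\<close>: the core columns are
  \<open>v\<close> and \<open>- \<pi> v\<close> for even \<open>M\<close>, and two copies of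
  \<open>v / 2\<close> with \<open>- \<pi> v\<close> for odd \<open>M\<close>, where
  \<open>n\<close> is odd and halving is a permutation.\<close>

lemma HWP_row_permutation:
  assumes M: "M \<ge> 3" and n: "n \<ge> 2" and par: "even M \<or> odd n" and H: "H \<subseteq> {..<n}" "card H = y"
    and \<pi>: "inj_on \<pi> {..<n}" "\<And>v. v < n \<Longrightarrow> \<pi> v < n"
    and cop: "\<And>v. v \<in> H \<Longrightarrow> coprime (int v - int (\<pi> v)) (int n)"
    and fixed: "\<And>v. v < n \<Longrightarrow> v \<notin> H \<Longrightarrow> \<pi> v = v"
  shows "hwp_lexC M n y"
proof (cases "even M")
  case True
  then obtain j where "M = 2 * j" by blast
  then have "M = 2 + 2 * (j - 1)" using M by auto
  then obtain k where k: "M = 2 + 2 * k" by blast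
  show ?thesis
    by (rule cyclic_HWP[OF M _ n H, where cs = "[\<lambda>v. int v, \<lambda>v. - int (\<pi> v)]" and k = k])
       (use k cop fixed inj_on_mod_column[OF \<pi>, of 0] inj_on_mod_column[of "\<lambda>v. v" n 0] in auto)
next
  case False
  then have "odd n" using par by simp
  obtain k where k: "M = 3 + 2 * k" using odd_ge3E False M by blast
  obtain h where h: "n = 2 * h + 1" using \<open>odd n\<close> by (rule oddE)
  \<comment> \<open>\<open>h + 1\<close> is the inverse of 2 modulo
    \<open>2 * h + 1\<close>.\<close>
  have half: "[2 * (int v * (int h + 1)) = int v] (mod int n)" for v
  proof -
    have "2 * (int v * (int h + 1)) - int v = int n * int v" by (simp add: h algebra_simps)
    then show ?thesis unfolding cong_iff_dvd_diff by (rule dvdI)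
  qed
  have injh: "inj_on (\<lambda>v. int v * (int h + 1) mod int n) {..<n}"
  proof (rule inj_onI)
    fix v w assume vw: "v \<in> {..<n}" "w \<in> {..<n}" "int v * (int h + 1) mod int n = int w * (int h + 1) mod int n"
    then have "[2 * (int v * (int h + 1)) = 2 * (int w * (int h + 1))] (mod int n)"
      by (intro cong_scalar_left) (simp add: cong_def)
    from cong_trans[OF cong_trans[OF cong_sym[OF half] this] half]
    have "[int v = int w] (mod int n)" .
    then show "v = w" using vw by (simp add: cong_def)
  qed
  let ?cs = "[\<lambda>v. int v * (int h + 1), \<lambda>v. int v * (int h + 1), \<lambda>v. - int (\<pi> v)]"
  have sum: "[(\<Sum>f\<leftarrow>?cs. f v) = int v - int (\<pi> v)] (mod int n)" for v
    using cong_diff[OF half[of v] cong_refl[of "int (\<pi> v)"]] by simp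
  show ?thesis
  proof (rule cyclic_HWP[OF M _ n H, where cs = ?cs and k = k])
    show "M = length ?cs + 2 * k" using k by simp
    show "inj_on (\<lambda>v. f v mod int n) {..<n}" if "f \<in> set ?cs" for f
      using that injh inj_on_mod_column(2)[OF \<pi>, of 0] by auto
    show "coprime (\<Sum>f\<leftarrow>?cs. f v) (int n)" if "v \<in> H" for v
      using cop[OF that] cong_imp_coprime[OF cong_sym[OF sum]] by blast
    show "[(\<Sum>f\<leftarrow>?cs. f v) = 0] (mod int n)" if "v < n" "v \<notin> H" for v
      using sum[of v] fixed[OF that] by simp
  qed
qed

lemma perm_swaps_coprime:
  assumes "v \<notin> A" "a \<le> v" "v < a + 2 * w"
  shows "coprime (int v - int (perm_swaps A f a w v)) N"
  using perm_swaps_diff(1)[OF assms, of f] by (elim disjE) simp_all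

lemma HWP_even_swaps:
  assumes "M \<ge> 3" "n \<ge> 2" "even M \<or> odd n" "even y" "y \<le> n"
  shows "hwp_lexC M n y"
proof -
  obtain w where w: "y = 2 * w" using assms(4) by blast
  show ?thesis
  proof (rule HWP_row_permutation[OF assms(1-3), where H = "{..<y}" and \<pi> = "perm_swaps {} id 0 w"])
    fix v assume "v \<in> {..<y}"
    then show "coprime (int v - int (perm_swaps {} id 0 w v)) (int n)"
      using perm_swaps_coprime[of v "{}" 0 w id] w by auto
  qed (use assms w perm_swaps_inj[of id "{}" 0 w n] perm_swaps_diff(2)[of _ "{}" 0 w id] in auto)
qed

text \<open>A 3-cycle on the rows 0, 1, 2 makes the count odd; its differences -1, -1 and 2 are
  units since \<open>n\<close> is odd.\<close>

lemma HWP_odd_swaps: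
  assumes "M \<ge> 3" "n \<ge> 2" "odd n" "odd y" "3 \<le> y" "y \<le> n"
  shows "hwp_lexC M n y"
proof -
  obtain w where w: "y = 3 + 2 * w" using odd_ge3E assms(4,5) by blast
  define f where "f v = (if v = 0 then 1 else if v = 1 then 2 else (0 :: nat))" for v :: nat
  let ?A = "{0, 1, 2::nat}" and ?\<pi> = "perm_swaps {0, 1, 2} f 3 w"
  have inj: "inj_on ?\<pi> {..<n}" "\<And>v. v < n \<Longrightarrow> ?\<pi> v < n"
    by (rule perm_swaps_inj; use w assms in \<open>auto simp: f_def inj_on_def\<close>)+
  show ?thesis
  proof (rule HWP_row_permutation[OF assms(1,2), where H = "{..<y}" and \<pi> = ?\<pi>])
    fix v assume v: "v \<in> {..<y}"
    consider "v = 0" | "v = 1" | "v = 2" | "v \<ge> 3" by linarith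
    then show "coprime (int v - int (?\<pi> v)) (int n)"
    proof cases
      case 4
      then show ?thesis using perm_swaps_coprime[of v ?A 3 w f] w v by auto
    qed (use assms(3) in \<open>auto simp: perm_swaps_def f_def\<close>)
  next
    fix v assume "v \<notin> {..<y}"
    then show "?\<pi> v = v" using perm_swaps_diff(2)[of v ?A 3 w f] w by auto
  qed (use assms inj in auto)
qed

text \<open>A near-complete mapping: p and q are permutations of the residues modulo 2m with p v + q v = v, except for the
  last row v = 2m - 1.\<close>

definition near_p :: "nat \<Rightarrow> nat \<Rightarrow> nat" where
  "near_p m v = (if even v then v div 2 else m + v div 2)"

definition near_q :: "nat \<Rightarrow> nat \<Rightarrow> nat" where
  "near_q m v = (if even v then v div 2 else if v = 2 * m - 1 then m else m + v div 2 + 1)"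

lemma near_p_inj:
  shows "inj_on (near_p m) {..<2 * m}" "\<And>v. v < 2 * m \<Longrightarrow> near_p m v < 2 * m"
  by (auto simp: near_p_def inj_on_def elim!: evenE oddE)

lemma near_q_inj:
  shows "inj_on (near_q m) {..<2 * m}" "\<And>v. v < 2 * m \<Longrightarrow> near_q m v < 2 * m"
proof -
  have eo: "\<exists>j. v = 2 * j \<or> v = 2 * j + 1" for v :: nat by presburger
  show "near_q m v < 2 * m" if "v < 2 * m" for v
  proof -
    obtain j where "v = 2 * j \<or> v = 2 * j + 1" using eo by blast
    then show ?thesis using that by (auto simp: near_q_def)
  qed
  show "inj_on (near_q m) {..<2 * m}"
  proof (rule inj_onI)
    fix v w assume *: "v \<in> {..<2 * m}" "w \<in> {..<2 * m}" "near_q m v = near_q m w"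
    obtain j where j: "v = 2 * j \<or> v = 2 * j + 1" using eo by blast
    obtain k where k: "w = 2 * k \<or> w = 2 * k + 1" using eo by blast
    show "v = w" using j k * by (elim disjE) (auto simp: near_q_def split: if_splits)
  qed
qed

text \<open>In the last row the rule for odd \<open>v\<close> would give \<open>near_q\<close> the
  value \<open>2 * m\<close>, that is 0, already taken by row 0; only \<open>m\<close> is left over.
  A defect of \<open>m\<close> is unavoidable: two permutations total 0 modulo \<open>2 * m\<close>,
  the residues themselves total \<open>m\<close>.\<close>

lemma near_sum:
  assumes "v < 2 * m"
  shows "even v \<Longrightarrow> int (near_p m v) + int (near_q m v) = int v"
    and "odd v \<Longrightarrow> v \<noteq> 2 * m - 1 \<Longrightarrow> int (near_p m v) + int (near_q m v) = int v + 2 * int m"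
    and "int (near_p m (2 * m - 1)) + int (near_q m (2 * m - 1)) = 3 * int m - 1"
proof -
  show "int (near_p m v) + int (near_q m v) = int v" if "even v"
    using that by (auto simp: near_p_def near_q_def elim!: evenE)
  show "int (near_p m v) + int (near_q m v) = int v + 2 * int m" if "odd v" "v \<noteq> 2 * m - 1"
    using that by (auto simp: near_p_def near_q_def elim!: oddE)
  obtain l where "m = Suc l" using assms by (cases m) auto
  then show "int (near_p m (2 * m - 1)) + int (near_q m (2 * m - 1)) = 3 * int m - 1"
    by (auto simp: near_p_def near_q_def)
qed

lemma HWP_near_permutation:
  assumes M: "M \<ge> 3" "odd M" and m: "m > 0" and H: "H \<subseteq> {..<2 * m}" "card H = y"
    and \<pi>: "inj_on \<pi> {..<2 * m}" "\<And>v. v < 2 * m \<Longrightarrow> \<pi> v < 2 * m"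
    and last: "2 * m - 1 \<in> H" "coprime (3 * int m - 1 - int (\<pi> (2 * m - 1))) (2 * int m)"
    and cop: "\<And>v. v \<in> H \<Longrightarrow> v \<noteq> 2 * m - 1 \<Longrightarrow> coprime (int v - int (\<pi> v)) (2 * int m)"
    and fixed: "\<And>v. v < 2 * m \<Longrightarrow> v \<notin> H \<Longrightarrow> \<pi> v = v"
  shows "hwp_lexC M (2 * m) y"
proof -
  obtain k where k: "M = 3 + 2 * k" using odd_ge3E M by blast
  let ?cs = "[\<lambda>v. int (near_p m v), \<lambda>v. int (near_q m v), \<lambda>v. - int (\<pi> v)]"
  have sum: "[(\<Sum>f\<leftarrow>?cs. f v) = int v - int (\<pi> v)] (mod 2 * int m)" if "v < 2 * m" "v \<noteq> 2 * m - 1" for v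
  proof -
    have "int (near_p m v) + int (near_q m v) = int v + (if even v then 0 else 2 * int m)"
      using near_sum(1,2)[OF that(1)] that(2) by simp
    then have "(\<Sum>f\<leftarrow>?cs. f v) - (int v - int (\<pi> v)) = (if even v then 0 else 2 * int m)"
      by simp
    then show ?thesis unfolding cong_iff_dvd_diff by simp
  qed
  show ?thesis
  proof (rule cyclic_HWP[OF M(1) _ _ H, where cs = ?cs and k = k])
    show "M = length ?cs + 2 * k" using k by simp
    show "2 \<le> 2 * m" using m by simp
    show "inj_on (\<lambda>v. f v mod int (2 * m)) {..<2 * m}" if "f \<in> set ?cs" for f
      using that inj_on_mod_column(2)[OF \<pi>, of 0] inj_on_mod_column(1)[OF near_p_inj, of m 0]
        inj_on_mod_column(1)[OF near_q_inj, of m 0] by auto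
    show "coprime (\<Sum>f\<leftarrow>?cs. f v) (int (2 * m))" if "v \<in> H" for v
    proof (cases "v = 2 * m - 1")
      case True
      then have "(\<Sum>f\<leftarrow>?cs. f v) = 3 * int m - 1 - int (\<pi> (2 * m - 1))"
        using near_sum(3)[of 0 m] m by simp
      then show ?thesis using last(2) by (simp only: of_nat_mult of_nat_numeral)
    next
      case False
      then have "v < 2 * m" using that H by auto
      then have "coprime (\<Sum>f\<leftarrow>?cs. f v) (2 * int m)"
        using cop[OF that False] cong_imp_coprime[OF cong_sym[OF sum[OF _ False]]] by blast
      then show ?thesis by (simp only: of_nat_mult of_nat_numeral)
    qed
    show "[(\<Sum>f\<leftarrow>?cs. f v) = 0] (mod int (2 * m))" if "v < 2 * m" "v \<notin> H" for v
    proof -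
      have "v \<noteq> 2 * m - 1" using that last(1) by auto
      from sum[OF that(1) this] show ?thesis by (simp only: fixed[OF that] diff_self of_nat_mult of_nat_numeral)
    qed
  qed
qed

text \<open>Exchanging the entries of rows 0 and \<open>2 * m - 1\<close> gives the sums 1 modulo
  \<open>2 * m\<close> and \<open>3 * m - 1\<close>, which is odd as \<open>m\<close> is even. With
  the last row fixed by the permutation, its sum would be \<open>m\<close>, which is no
  unit.\<close>

lemma HWP_near_even:
  assumes M: "M \<ge> 3" "odd M" and m: "even m" "m > 0" and y: "even y" "2 \<le> y" "y \<le> 2 * m"
  shows "hwp_lexC M (2 * m) y"
proof -
  obtain w' where "y = 2 * w'" using y(1) by blast
  then obtain w where w: "y = 2 + 2 * w" using y(2) by (cases w') auto
  define f where "f v = (if v = 0 then 2 * m - 1 else 0)" for v :: nat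
  let ?A = "{0, 2 * m - 1}" and ?H = "{0, 2 * m - 1} \<union> {1..<1 + 2 * w}"
  let ?\<pi> = "perm_swaps ?A f 1 w"
  have inj: "inj_on ?\<pi> {..<2 * m}" "\<And>v. v < 2 * m \<Longrightarrow> ?\<pi> v < 2 * m"
    by (rule perm_swaps_inj; use w y m in \<open>auto simp: f_def inj_on_def\<close>)+
  show ?thesis
  proof (rule HWP_near_permutation[OF M m(2), where H = ?H and \<pi> = ?\<pi>])
    have "card ?H = card ?A + card {1..<1 + 2 * w}" by (rule card_Un_disjoint) (use w y in auto)
    then show "card ?H = y" using w m by auto
    have "?\<pi> (2 * m - 1) = 0" using m by (simp add: perm_swaps_def f_def)
    moreover have "coprime (3 * int m - 1) (2 * int m)"
      by (rule coprime_near[where k = 3 and z = "-2"]) (use m in auto)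
    ultimately show "coprime (3 * int m - 1 - int (?\<pi> (2 * m - 1))) (2 * int m)" by simp
  next
    fix v assume v: "v \<in> ?H" "v \<noteq> 2 * m - 1"
    show "coprime (int v - int (?\<pi> v)) (2 * int m)"
    proof (cases "v = 0")
      case True
      have "coprime (1 - 2 * int m) (2 * int m)"
        by (rule coprime_near[where k = "-2" and z = 2]) (use m in auto)
      then show ?thesis using True m by (simp add: perm_swaps_def f_def of_nat_diff)
    next
      case False
      then show ?thesis using v by (intro perm_swaps_coprime) auto
    qed
  next
    fix v assume "v \<notin> ?H" then show "?\<pi> v = v" using perm_swaps_diff(2)[of v ?A 1 w f] by auto
  qed (use inj w y m in auto)
qed

text \<open>For odd \<open>m\<close> the sum \<open>3 * m - 1\<close> would be even. The 3-cycle
  from 0 to \<open>2 * m - 1\<close> to 1 to 0 turns it into \<open>3 * m - 2\<close> and gives rows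
  0 and 1 the sum 1 modulo \<open>2 * m\<close>.\<close>

lemma HWP_near_odd:
  assumes M: "M \<ge> 3" "odd M" and m: "odd m" "m > 1" and y: "odd y" "3 \<le> y" "y \<le> 2 * m"
  shows "hwp_lexC M (2 * m) y"
proof -
  obtain w where w: "y = 3 + 2 * w" using odd_ge3E y by blast
  then have w2: "3 + 2 * w < 2 * m" using y by (metis dvd_triv_left le_neq_implies_less)
  define f where "f v = (if v = 0 then 2 * m - 1 else if v = 1 then 0 else 1)" for v :: nat
  let ?A = "{0, 1, 2 * m - 1}" and ?H = "{0, 1, 2 * m - 1} \<union> {2..<2 + 2 * w}"
  let ?\<pi> = "perm_swaps ?A f 2 w"
  have inj: "inj_on ?\<pi> {..<2 * m}" "\<And>v. v < 2 * m \<Longrightarrow> ?\<pi> v < 2 * m"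
    by (rule perm_swaps_inj; use w2 m in \<open>auto simp: f_def inj_on_def\<close>)+
  have m0: "m > 0" using m by simp
  show ?thesis
  proof (rule HWP_near_permutation[OF M m0, where H = ?H and \<pi> = ?\<pi>])
    have "card ?H = card ?A + card {2..<2 + 2 * w}" by (rule card_Un_disjoint) (use w2 in auto)
    moreover have "card ?A = 3" using m by auto
    ultimately show "card ?H = y" using w by simp
    have "?\<pi> (2 * m - 1) = 1" using m by (simp add: perm_swaps_def f_def)
    moreover have "coprime (3 * int m - 2) (2 * int m)"
      by (rule coprime_near[where k = 3 and z = "-4"]) (use m in auto)
    ultimately show "coprime (3 * int m - 1 - int (?\<pi> (2 * m - 1))) (2 * int m)" by simp
  next
    fix v assume v: "v \<in> ?H" "v \<noteq> 2 * m - 1"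
    consider "v = 0" | "v = 1" | "v \<ge> 2" by linarith
    then show "coprime (int v - int (?\<pi> v)) (2 * int m)"
    proof cases
      case 1
      have "coprime (1 - 2 * int m) (2 * int m)"
        by (rule coprime_near[where k = "-2" and z = 2]) (use m in auto)
      then show ?thesis using 1 m by (simp add: perm_swaps_def f_def of_nat_diff)
    next
      case 2
      then show ?thesis by (simp add: perm_swaps_def f_def)
    next
      case 3
      then show ?thesis using v by (intro perm_swaps_coprime) auto
    qed
  next
    fix v assume "v \<notin> ?H" then show "?\<pi> v = v" using perm_swaps_diff(2)[of v ?A 2 w f] by auto
  qed (use inj w2 m in auto)
qed

lemma HWP_two_one:
  assumes M: "M \<ge> 3" "odd M"
  shows "hwp_lexC M 2 1"
proof -
  obtain k where k: "M = 3 + 2 * k" using odd_ge3E M by blast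
  have I: "inj_on (\<lambda>v. int v mod 2) {..<2}" "inj_on (\<lambda>v. - int v mod 2) {..<2}"
    using inj_on_mod_column[of "\<lambda>v. v" 2 0] by auto
  show ?thesis
  proof (rule cyclic_HWP[OF M(1), where cs = "[int, int, \<lambda>v. - int v]" and k = k and H = "{1}"])
    fix v :: nat assume "v < 2" "v \<notin> {1}"
    then have "v = 0" by simp
    then show "[(\<Sum>f\<leftarrow>[int, int, \<lambda>v. - int v]. f v) = 0] (mod int 2)" by simp
  qed (use k I in auto)
qed

text \<open>The two rows 0, 0, 0 and 1, -1, -1 are exactly a twistable pair.\<close>

lemma HWP_two_two:
  assumes M: "M \<ge> 3" "odd M"
  shows "hwp_lexC M 2 2"
proof -
  obtain k where k: "M = 3 + 2 * k" using odd_ge3E M by blast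
  have I: "inj_on (\<lambda>v. int v mod 2) {..<2}" "inj_on (\<lambda>v. - int v mod 2) {..<2}"
    using inj_on_mod_column[of "\<lambda>v. v" 2 0] by auto
  show ?thesis
    by (rule cyclic_HWP_twisted[OF M(1), where f = int and g = "\<lambda>v. - int v" and cs = "[\<lambda>v. - int v]"
          and k = k and H = "{0, 1}" and a = 0 and b = 1])
       (use k I in auto)
qed

text \<open>Behind the twisted columns \<open>v\<close> and \<open>- v\<close>, rows 0 and 1 must
  sum to 0 and -1; two further columns \<open>v\<close> and \<open>- \<pi> v\<close> achieve this
  with \<open>\<pi> 0 = 0\<close> and \<open>\<pi> 1 = 2\<close>. Then \<open>\<pi> 2 = 1\<close>
  makes row 2 the third Hamilton row.\<close>

lemma HWP_twisted_even:
  assumes M: "M \<ge> 3" "even M" and n: "even n" and y: "odd y" "3 \<le> y" "y \<le> n"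
  shows "hwp_lexC M n y"
proof -
  obtain j where "M = 2 * j" using M(2) by blast
  then have "M = 4 + 2 * (j - 2)" using M(1) by auto
  then obtain k where k: "M = 4 + 2 * k" by blast
  obtain w where w: "y = 3 + 2 * w" using odd_ge3E y by blast
  define f where "f v = (if v = 1 then 2 else if v = 2 then 1 else (0 :: nat))" for v :: nat
  let ?A = "{0, 1, 2::nat}"
  let ?\<pi> = "perm_swaps ?A f 3 w"
  have inj: "inj_on ?\<pi> {..<n}" "\<And>v. v < n \<Longrightarrow> ?\<pi> v < n"
    by (rule perm_swaps_inj; use w y in \<open>auto simp: f_def inj_on_def\<close>)+
  have pi: "?\<pi> 0 = 0" "?\<pi> (Suc 0) = 2" "?\<pi> 2 = 1" by (auto simp: perm_swaps_def f_def)
  have I: "inj_on (\<lambda>v. int v mod int n) {..<n}" "inj_on (\<lambda>v. - int v mod int n) {..<n}"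
    "inj_on (\<lambda>v. - int (?\<pi> v) mod int n) {..<n}"
    using inj_on_mod_column[of "\<lambda>v. v" n 0] inj_on_mod_column(2)[OF inj, of 0] by auto
  show ?thesis
  proof (rule cyclic_HWP_twisted[OF M(1), where f = int and g = "\<lambda>v. - int v"
          and cs = "[int, \<lambda>v. - int (?\<pi> v)]" and k = k and H = "{..<y}" and a = 0 and b = 1])
    fix v assume v: "v \<in> {..<y}" "v \<noteq> 0" "v \<noteq> 1"
    show "coprime (int v + - int v + (\<Sum>h\<leftarrow>[int, \<lambda>v. - int (?\<pi> v)]. h v)) (int n)"
    proof (cases "v = 2")
      case True then show ?thesis using pi by simp
    next
      case False
      then show ?thesis using v w perm_swaps_coprime[of v ?A 3 w f] by auto
    qed
  next
    fix v assume "v \<notin> {..<y}"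
    then have "?\<pi> v = v" using w perm_swaps_diff(2)[of v ?A 3 w f] by auto
    then show "[int v + - int v + (\<Sum>h\<leftarrow>[int, \<lambda>v. - int (?\<pi> v)]. h v) = 0] (mod int n)" by simp
  qed (use k I y n pi in auto)
qed

section \<open>Twisted matrices for odd \<open>M\<close> and even \<open>n\<close>\<close>

definition cross :: "nat \<Rightarrow> nat \<Rightarrow> nat" where
  "cross n v = (if v = 0 then 2 else if v = 2 then 0 else if v = 1 then n - 1 else if v = n - 1 then 1 else v)"

lemma cross_inj:
  assumes "n \<ge> 4"
  shows "inj_on (cross n) {..<n}" "\<And>v. v < n \<Longrightarrow> cross n v < n"
  using assms by (auto simp: cross_def inj_on_def split: if_splits)

text \<open>A twistable pair needs one column to rise by 1 while the other falls by 1. Both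
  \<open>near_p\<close> and \<open>near_q\<close> take the values 0 and 1 in rows 0 and 2, so these
  rows are exchanged in \<open>near_q\<close>. Exchanging rows 1 and \<open>2 * m - 1\<close> too
  makes the sums of the two columns there \<open>2 * m\<close> and \<open>3 * m\<close>.\<close>

lemma near_q_cross:
  assumes "m \<ge> 2"
  shows "inj_on (\<lambda>v. near_q m (cross (2 * m) v)) {..<2 * m}"
    "\<And>v. v < 2 * m \<Longrightarrow> near_q m (cross (2 * m) v) < 2 * m"
    "near_q m (cross (2 * m) 0) = 1" "near_q m (cross (2 * m) 2) = 0"
    "near_q m (cross (2 * m) (Suc 0)) = m" "near_q m (cross (2 * m) (2 * m - 1)) = m + 1"
    "\<And>v. 3 \<le> v \<Longrightarrow> v < 2 * m - 1 \<Longrightarrow> cross (2 * m) v = v"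
proof -
  have 4: "2 * m \<ge> 4" using assms by simp
  have "inj_on (near_q m) (cross (2 * m) ` {..<2 * m})"
    by (rule inj_on_subset[OF near_q_inj(1)[of m]]) (use cross_inj(2)[OF 4] in auto)
  then show "inj_on (\<lambda>v. near_q m (cross (2 * m) v)) {..<2 * m}"
    using comp_inj_on[OF cross_inj(1)[OF 4]] by (simp add: comp_def)
  show "near_q m (cross (2 * m) v) < 2 * m" if "v < 2 * m" for v
    using near_q_inj(2) cross_inj(2)[OF 4 that] by blast
qed (use assms in \<open>auto simp: cross_def near_q_def\<close>)

lemma near_p_values:
  "near_p m 0 = 0" "near_p m 2 = 1" "near_p m (Suc 0) = m" "m > 0 \<Longrightarrow> near_p m (2 * m - 1) = 2 * m - 1"
  by (auto simp: near_p_def)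

text \<open>Rows 0 and 2 form the pair, which forces \<open>\<pi> 0 = 1\<close> and
  \<open>\<pi> 2 = 2\<close>. With \<open>\<pi> 1 = 0\<close> row 1 has sum 0 modulo
  \<open>2 * m\<close> and stays outside \<open>H\<close>; the fixed last row has sum
  \<open>m + 1\<close>, a unit as \<open>m\<close> is even.\<close>

lemma HWP_twisted_odd_M_odd_y:
  assumes M: "M \<ge> 3" "odd M" and m: "even m" "m > 0" and y: "odd y" "3 \<le> y" "y \<le> 2 * m"
  shows "hwp_lexC M (2 * m) y"
proof -
  obtain k where k: "M = 3 + 2 * k" using odd_ge3E M by blast
  obtain w where w: "y = 3 + 2 * w" using odd_ge3E y by blast
  then have w2: "3 + 2 * w < 2 * m" using y by (metis dvd_triv_left le_neq_implies_less)
  have m2: "m \<ge> 2" using m by (auto elim!: evenE)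
  define f where "f v = (if v = 0 then 1 else if v = 1 then 0 else v)" for v :: nat
  let ?A = "{0, 1, 2, 2 * m - 1}" and ?H = "{0, 2, 2 * m - 1} \<union> {3..<3 + 2 * w}"
  let ?\<pi> = "perm_swaps ?A f 3 w"
  have inj: "inj_on ?\<pi> {..<2 * m}" "\<And>v. v < 2 * m \<Longrightarrow> ?\<pi> v < 2 * m"
    by (rule perm_swaps_inj; use w2 m2 in \<open>auto simp: f_def inj_on_def\<close>)+
  have pi: "?\<pi> 0 = 1" "?\<pi> (Suc 0) = 0" "?\<pi> 2 = 2" "?\<pi> (2 * m - 1) = 2 * m - 1"
    using m2 by (auto simp: perm_swaps_def f_def)
  define p where "p v = int (near_p m v)" for v
  define q where "q v = int (near_q m (cross (2 * m) v)) - 1" for v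
  define r where "r v = 1 - int (?\<pi> v)" for v
  have I: "inj_on (\<lambda>v. p v mod int (2 * m)) {..<2 * m}" "inj_on (\<lambda>v. q v mod int (2 * m)) {..<2 * m}"
    "inj_on (\<lambda>v. r v mod int (2 * m)) {..<2 * m}"
    using inj_on_mod_column(1)[OF near_p_inj, of m 0] inj_on_mod_column(1)[OF near_q_cross(1,2)[OF m2], of "-1"]
      inj_on_mod_column(2)[OF inj, of 1] by (simp_all add: p_def q_def r_def)
  have sum: "[p v + q v + r v = int v - int (?\<pi> v)] (mod 2 * int m)" if "3 \<le> v" "v < 2 * m - 1" for v
  proof -
    have "int (near_p m v) + int (near_q m v) = int v + (if even v then 0 else 2 * int m)"
      using near_sum(1,2)[of v m] that by simp
    then have "p v + q v + r v = int v - int (?\<pi> v) + (if even v then 0 else 2 * int m)"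
      unfolding p_def q_def r_def near_q_cross(7)[OF m2 that] by linarith
    then show ?thesis by (simp only: cong_iff_dvd_diff) simp
  qed
  show ?thesis
  proof (rule cyclic_HWP_twisted[OF M(1), where f = p and g = q and cs = "[r]" and k = k and H = ?H and a = 0 and b = 2])
    have "card ?H = card {0, 2, 2 * m - 1} + card {3..<3 + 2 * w}" by (rule card_Un_disjoint) (use w2 in auto)
    moreover have "card {0, 2, 2 * m - 1} = 3" using m2 by auto
    ultimately show "card ?H = y" using w by simp
  next
    fix v assume v: "v \<in> ?H" "v \<noteq> 0" "v \<noteq> 2"
    show "coprime (p v + q v + (\<Sum>h\<leftarrow>[r]. h v)) (int (2 * m))"
    proof (cases "v = 2 * m - 1")
      case True
      have "coprime (int m + 1) (2 * int m)"
        by (rule coprime_near[where k = 1 and z = 2]) (use m in auto)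
      moreover have "p v + q v + (\<Sum>h\<leftarrow>[r]. h v) = int m + 1"
        using m2 pi(4) near_q_cross(6)[OF m2] near_p_values(4)[OF m(2)] True
        by (simp add: p_def q_def r_def)
      ultimately show ?thesis by (simp only: of_nat_mult of_nat_numeral)
    next
      case False
      then have "3 \<le> v" "v < 2 * m - 1" "v < 3 + 2 * w" using v w2 by auto
      moreover from this have "coprime (int v - int (?\<pi> v)) (2 * int m)"
        using False by (intro perm_swaps_coprime) auto
      ultimately have "coprime (p v + q v + r v) (2 * int m)"
        using cong_imp_coprime[OF cong_sym[OF sum]] by blast
      then show ?thesis by simp
    qed
  next
    fix v assume v: "v < 2 * m" "v \<notin> ?H"
    show "[p v + q v + (\<Sum>h\<leftarrow>[r]. h v) = 0] (mod int (2 * m))"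
    proof (cases "v = 1")
      case True
      then show ?thesis using pi near_q_cross[OF m2] near_p_values[of m] m2
        by (simp add: p_def q_def r_def cong_iff_dvd_diff)
    next
      case False
      then have "3 \<le> v" "v < 2 * m - 1" "3 + 2 * w \<le> v" using v by auto
      then show ?thesis using sum[of v] perm_swaps_diff(2)[of v ?A 3 w f] by auto
    qed
  next
    show "M = length (p # q # [r]) + 2 * k" using k by simp
    show "?H \<subseteq> {..<2 * m}" using w2 m2 by auto
    show "inj_on (\<lambda>v. h v mod int (2 * m)) {..<2 * m}" if "h \<in> set (p # q # [r])" for h
      using that I by auto
    have val: "p 0 = 0" "q 0 = 0" "r 0 = 0" "p 2 = 1" "q 2 = - 1" "r 2 = - 1"
      using pi(1,3) near_q_cross(3,4)[OF m2] near_p_values(1,2)[of m] by (simp_all add: p_def q_def r_def)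
    show "[p 0 = 0] (mod int (2 * m))" "[q 0 = 0] (mod int (2 * m))" "[(\<Sum>h\<leftarrow>[r]. h 0) = 0] (mod int (2 * m))"
      "[p 2 = 1] (mod int (2 * m))" "[q 2 = - 1] (mod int (2 * m))" "[(\<Sum>h\<leftarrow>[r]. h 2) = - 1] (mod int (2 * m))"
      by (simp_all add: val)
  qed (use m2 in simp_all)
qed

text \<open>Up to a translation of columns the matrix for odd \<open>y\<close> is negated, which
  exchanges the parts of rows 0 and 2. This forces \<open>\<pi> 0 = 0\<close> and
  \<open>\<pi> 2 = 1\<close> and leaves \<open>2 * m - 1\<close> and 2 for rows 1 and
  \<open>2 * m - 1\<close>, with unit sums -1 and \<open>2 - 3 * m\<close>. Without the negation the
  entries left over would be 0 and \<open>2 * m - 1\<close>, and rows 1 and \<open>2 * m - 1\<close>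
  could not both get unit sums.\<close>

lemma HWP_twisted_odd_M_even_y:
  assumes M: "M \<ge> 3" "odd M" and m: "odd m" "m > 1" and y: "even y" "4 \<le> y" "y \<le> 2 * m"
  shows "hwp_lexC M (2 * m) y"
proof -
  obtain k where k: "M = 3 + 2 * k" using odd_ge3E M by blast
  obtain j where "y = 2 * j" using y(1) by blast
  then have "y = 4 + 2 * (j - 2)" using y(2) by auto
  then obtain w where w: "y = 4 + 2 * w" by blast
  have m2: "m \<ge> 2" and m3: "m \<ge> 3" using m by (auto elim!: oddE)
  define f where "f v = (if v = 0 then 0 else if v = 1 then 2 * m - 1 else if v = 2 then 1 else 2)" for v :: nat
  let ?A = "{0, 1, 2, 2 * m - 1}" and ?H = "{0, 1, 2, 2 * m - 1} \<union> {3..<3 + 2 * w}"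
  let ?\<pi> = "perm_swaps ?A f 3 w"
  have inj: "inj_on ?\<pi> {..<2 * m}" "\<And>v. v < 2 * m \<Longrightarrow> ?\<pi> v < 2 * m"
    by (rule perm_swaps_inj; use w y m3 in \<open>auto simp: f_def inj_on_def\<close>)+
  have pi: "?\<pi> 0 = 0" "?\<pi> (Suc 0) = 2 * m - 1" "?\<pi> 2 = 1" "?\<pi> (2 * m - 1) = 2"
    using m3 by (auto simp: perm_swaps_def f_def)
  define p where "p v = 1 - int (near_p m v)" for v
  define q where "q v = 0 - int (near_q m (cross (2 * m) v))" for v
  define r where "r v = int (?\<pi> v) + (- 1)" for v
  have I: "inj_on (\<lambda>v. p v mod int (2 * m)) {..<2 * m}" "inj_on (\<lambda>v. q v mod int (2 * m)) {..<2 * m}"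
    "inj_on (\<lambda>v. r v mod int (2 * m)) {..<2 * m}"
    using inj_on_mod_column(2)[OF near_p_inj, of m 1] inj_on_mod_column(2)[OF near_q_cross(1,2)[OF m2], of 0]
      inj_on_mod_column(1)[OF inj, of "-1"] by (simp_all add: p_def q_def r_def)
  have sum: "[p v + q v + r v = - (int v - int (?\<pi> v))] (mod 2 * int m)" if "3 \<le> v" "v < 2 * m - 1" for v
  proof -
    have "int (near_p m v) + int (near_q m v) = int v + (if even v then 0 else 2 * int m)"
      using near_sum(1,2)[of v m] that by simp
    then have "p v + q v + r v = - (int v - int (?\<pi> v)) - (if even v then 0 else 2 * int m)"
      unfolding p_def q_def r_def near_q_cross(7)[OF m2 that] by linarith
    then show ?thesis by (simp only: cong_iff_dvd_diff) simp
  qed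
  show ?thesis
  proof (rule cyclic_HWP_twisted[OF M(1), where f = p and g = q and cs = "[r]" and k = k and H = ?H and a = 2 and b = 0])
    have "card ?H = card ?A + card {3..<3 + 2 * w}" by (rule card_Un_disjoint) (use w y in auto)
    moreover have "card ?A = 4" using m3 by auto
    ultimately show "card ?H = y" using w by simp
  next
    fix v assume v: "v \<in> ?H" "v \<noteq> 2" "v \<noteq> 0"
    have "v = 1 \<or> v = 2 * m - 1 \<or> 3 \<le> v \<and> v < 3 + 2 * w" using v by auto
    moreover have "3 + 2 * w \<le> 2 * m - 1" using w y by simp
    ultimately consider "v = 1" | "v = 2 * m - 1" | "3 \<le> v" "v < 2 * m - 1" "v < 3 + 2 * w" by linarith
    then show "coprime (p v + q v + (\<Sum>h\<leftarrow>[r]. h v)) (int (2 * m))"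
    proof cases
      case 1
      then show ?thesis using m2 pi near_q_cross[OF m2] near_p_values[of m]
        by (simp add: p_def q_def r_def of_nat_diff)
    next
      case 2
      have "coprime (2 - 3 * int m) (2 * int m)"
        by (rule coprime_near[where k = "-3" and z = 4]) (use m in auto)
      moreover have "near_p m (2 * m - 1) = 2 * m - 1" using m by (intro near_p_values) auto
      then have "p v + q v + (\<Sum>h\<leftarrow>[r]. h v) = 2 - 3 * int m"
        using m2 pi(4) near_q_cross(6)[OF m2] 2 by (simp add: p_def q_def r_def of_nat_diff)
      ultimately show ?thesis by (simp only: of_nat_mult of_nat_numeral)
    next
      case 3
      then have "coprime (int v - int (?\<pi> v)) (2 * int m)"
        by (intro perm_swaps_coprime) auto
      then have "coprime (- (int v - int (?\<pi> v))) (2 * int m)" by (simp only: coprime_minus_left_iff)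
      then have "coprime (p v + q v + r v) (2 * int m)"
        using cong_imp_coprime[OF cong_sym[OF sum[OF 3(1,2)]]] by blast
      then show ?thesis by simp
    qed
  next
    fix v assume v: "v < 2 * m" "v \<notin> ?H"
    then have "3 \<le> v" "v < 2 * m - 1" "3 + 2 * w \<le> v" by auto
    then show "[p v + q v + (\<Sum>h\<leftarrow>[r]. h v) = 0] (mod int (2 * m))"
      using sum[of v] perm_swaps_diff(2)[of v ?A 3 w f] by auto
  next
    show "M = length (p # q # [r]) + 2 * k" using k by simp
    show "?H \<subseteq> {..<2 * m}" using w y m2 by auto
    show "inj_on (\<lambda>v. h v mod int (2 * m)) {..<2 * m}" if "h \<in> set (p # q # [r])" for h
      using that I by auto
    have val: "p 2 = 0" "q 2 = 0" "r 2 = 0" "p 0 = 1" "q 0 = - 1" "r 0 = - 1"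
      using pi(1,3) near_q_cross(3,4)[OF m2] near_p_values(1,2)[of m] by (simp_all add: p_def q_def r_def)
    show "[p 2 = 0] (mod int (2 * m))" "[q 2 = 0] (mod int (2 * m))" "[(\<Sum>h\<leftarrow>[r]. h 2) = 0] (mod int (2 * m))"
      "[p 0 = 1] (mod int (2 * m))" "[q 0 = - 1] (mod int (2 * m))" "[(\<Sum>h\<leftarrow>[r]. h 0) = - 1] (mod int (2 * m))"
      by (simp_all add: val)
  qed (use m2 in simp_all)
qed

text \<open>Groups 0, 1, 2 colour the layers and group 3 numbers the factors. A block traces one
  \<open>M\<close>-cycle; its points in two adjacent layers fix the block and so the factor, while
  one point and the factor fix the cycle.\<close>

lemma HWP_transversal_design:
  assumes "has_TD4 n" "n > 0" and M: "M \<ge> 3" "odd M"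
  shows "hwp_lexC M n 0"
proof -
  obtain S where S: "transversal_design 4 {..<n} S" using assms(1) by (auto simp: has_TD4_def)
  \<comment> \<open>A proper 3-colouring of the odd cycle: colour 0 occurs in layer 0 only, then 1
    and 2 alternate, and the last layer, of even index, has colour 2.\<close>
  define c where "c i = (if i = 0 then 0 else if odd i then 1 else (2::nat))" for i :: nat
  have c4: "c i < 4" "c i \<noteq> 3" for i by (auto simp: c_def)
  have c_next: "c i \<noteq> c ((i + 1) mod M)" if "i < M" for i
    using that M by (cases "i + 1 = M") (auto simp: c_def)
  define D where "D t i x y \<longleftrightarrow> (\<exists>b\<in>S. b 3 = t \<and> b (c i) = x \<and> b (c ((i + 1) mod M)) = y)" for t i x y
  define L where "L b = map (\<lambda>i. (i, b (c i) :: nat)) [0..<M]" for b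
  have bn: "b (c i) < n" if "b \<in> S" for b i
    using transversal_designD(1)[OF S that c4(1)] by simp
  have step: "arc_step M n (D t) (i, b (c i)) ((i + 1) mod M, b (c ((i + 1) mod M)))"
    if "b \<in> S" "b 3 = t" "i < M" for b t i
    unfolding arc_step_def
    by (rule exI[of _ i], rule conjI[OF that(3)], rule exI[of _ "b (c i)"], rule conjI[OF bn[OF that(1)]],
        rule exI[of _ "b (c ((i + 1) mod M))"], rule conjI[OF bn[OF that(1)]])
       (use that in \<open>auto simp: D_def arc_def\<close>)
  have "(n - 0, 0) \<in> HWP (lexC_verts M n) (lexC_edges M n) M (M * n)"
  proof (rule HWP_intro[OF M(1), where H = "{}" and D = D])
    fix t assume t: "t < n"
    have "cycle_factorable M n M (D t)"
      unfolding cycle_factorable_def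
    proof (intro exI[of _ "L ` {b \<in> S. b 3 = t}"] conjI)
      show "\<forall>vs\<in>L ` {b \<in> S. b 3 = t}. is_k_cycle M vs \<and>
          successively (arc_step M n (D t)) vs \<and> arc_step M n (D t) (last vs) (hd vs)"
      proof (intro ballI conjI)
        fix vs assume "vs \<in> L ` {b \<in> S. b 3 = t}"
        then obtain b where b: "b \<in> S" "b 3 = t" "vs = L b" by blast
        show "is_k_cycle M vs" using M by (auto simp: b(3) L_def is_k_cycle_def distinct_map inj_on_def)
        show "successively (arc_step M n (D t)) vs"
          unfolding b(3) L_def successively_map
        proof (rule successively_upt)
          fix i assume "Suc i < M"
          then show "arc_step M n (D t) (i, b (c i)) (Suc i, b (c (Suc i)))"
            using step[OF b(1,2), of i] by simp
        qed
        obtain k where k: "M = Suc k" using M by (cases M) auto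
        have "last vs = (k, b (c k))" by (simp add: b(3) L_def k)
        moreover have "hd vs = (0, b (c 0))" using M by (simp add: b(3) L_def hd_map)
        ultimately show "arc_step M n (D t) (last vs) (hd vs)"
          using step[OF b(1,2), of k] k by simp
      qed
      show "\<forall>vs\<in>L ` {b \<in> S. b 3 = t}. \<forall>ws\<in>L ` {b \<in> S. b 3 = t}. vs \<noteq> ws \<longrightarrow> set vs \<inter> set ws = {}"
      proof (intro ballI impI, rule ccontr)
        fix vs ws assume "vs \<in> L ` {b \<in> S. b 3 = t}" "ws \<in> L ` {b \<in> S. b 3 = t}"
          and ne: "vs \<noteq> ws" and int: "set vs \<inter> set ws \<noteq> {}"
        then obtain b d where b: "b \<in> S" "b 3 = t" "vs = L b" and d: "d \<in> S" "d 3 = t" "ws = L d" by blast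
        obtain i where "b (c i) = d (c i)" using int unfolding b(3) d(3) L_def by force
        then have "b l = d l" if "l < 4" for l
          using transversal_designD(3)[OF S b(1) d(1) c4(1) _ c4(2) _ _ that] b(2) d(2) by simp
        then have "L b = L d" using c4 by (simp add: L_def)
        then show False using ne b d by simp
      qed
      show "(\<Union>vs\<in>L ` {b \<in> S. b 3 = t}. set vs) = lexC_verts M n"
      proof (intro equalityI subsetI)
        fix v assume "v \<in> lexC_verts M n"
        then obtain i x where v: "v = (i, x)" "i < M" "x < n" by (auto simp: lexC_verts_def)
        obtain b where b: "b \<in> S" "b (c i) = x" "b 3 = t"
          using transversal_designD(2)[OF S c4(1)[of i] _ c4(2)[of i], of x t] v t by auto
        then have "v \<in> set (L b)" using v by (auto simp: L_def)
        then show "v \<in> (\<Union>vs\<in>L ` {b \<in> S. b 3 = t}. set vs)" using b by blast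
      next
        fix v assume "v \<in> (\<Union>vs\<in>L ` {b \<in> S. b 3 = t}. set vs)"
        then show "v \<in> lexC_verts M n" using bn by (auto simp: L_def lexC_verts_def)
      qed
    qed
    then show "cycle_factorable M n (if t \<in> {} then M * n else M) (D t)" by simp
  next
    fix t t' i x z assume "i < M" and D: "D t i x z" "D t' i x z"
    obtain b where b: "b \<in> S" "b 3 = t" "b (c i) = x" "b (c ((i + 1) mod M)) = z" using D(1) by (auto simp: D_def)
    obtain d where d: "d \<in> S" "d 3 = t'" "d (c i) = x" "d (c ((i + 1) mod M)) = z" using D(2) by (auto simp: D_def)
    have "b 3 = d 3"
      by (rule transversal_designD(3)[OF S b(1) d(1) c4(1) c4(1) c_next[OF \<open>i < M\<close>]]) (use b d in auto)
    then show "t = t'" using b d by simp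
  qed auto
  then show ?thesis by simp
qed

theorem mainTheorem7:
  fixes n M y :: nat
  assumes "n \<ge> 2" and "M \<ge> 3" and "y \<le> n"
    and "\<not> (y = 1 \<and> \<not> (n = 2 \<and> odd M))"
    and "\<not> (y = 2 \<and> 2 < n \<and> n mod 4 = 2 \<and> odd M)"
    and "\<not> ((y, n) \<in> {(0, 2), (0, 6)} \<and> odd M)"
  shows "(n - y, y) \<in> HWP (lexC_verts M n) (lexC_edges M n) M (M * n)"
proof -
  have y1: "y = 1 \<Longrightarrow> n = 2 \<and> odd M" using assms(4) by blast
  consider (perm) "even M \<or> odd n" "even y" | (odd_n) "odd n" "odd y" | (even_even) "even n" "even M" "odd y"
    | (even_odd) "even n" "odd M" by blast
  then show ?thesis
  proof cases
    case perm
    then show ?thesis using HWP_even_swaps assms by blast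
  next
    case odd_n
    then have "y \<noteq> 1" using y1 by auto
    then have "3 \<le> y" using odd_n by presburger
    then show ?thesis using HWP_odd_swaps assms odd_n by blast
  next
    case even_even
    then have "y \<noteq> 1" using y1 by auto
    then have "3 \<le> y" using even_even by presburger
    then show ?thesis using HWP_twisted_even assms even_even by blast
  next
    case even_odd
    obtain m where m: "n = 2 * m" using even_odd by blast
    have m0: "m > 0" using m assms(1) by simp
    have mod: "n mod 4 = 2" if "odd m" using that m by presburger
    \<comment> \<open>By the total of the matrix, positive \<open>y\<close> of the parity of
      \<open>m\<close> can be had without a twist; the other parity takes a twisted pair.\<close>
    consider (zero) "y = 0" | (one) "y = 1" | (two) "n = 2" "y = 2"
      | (ee) "even m" "even y" "2 \<le> y" | (eo) "even m" "odd y" "3 \<le> y"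
      | (oo) "odd m" "m > 1" "odd y" "3 \<le> y" | (oe) "odd m" "m > 1" "even y" "2 \<le> y"
    proof -
      have "m = 1 \<or> m > 1" using m0 by linarith
      moreover have "y = 0 \<or> y = 1 \<or> even y \<and> 2 \<le> y \<or> odd y \<and> 3 \<le> y" by presburger
      moreover have "y \<le> 2 * m" using assms(3) m by simp
      ultimately show ?thesis using that m by fastforce
    qed
    then show ?thesis
    proof cases
      case zero
      then have n26: "n \<noteq> 2" "n \<noteq> 6" using assms(6) even_odd by auto
      have "has_TD4 n"
      proof (cases "even m")
        case True
        then obtain k where "m = 2 * k" by blast
        then show ?thesis using has_TD4_mult_4[of k] m m0 by simp
      next
        case False
        then have "m \<noteq> 1" "m \<noteq> 3" using n26 m by auto
        with False m0 have "m \<ge> 5" by presburger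
        then show ?thesis using has_TD4_2_mod_4[OF mod[OF False]] m by simp
      qed
      then show ?thesis using HWP_transversal_design[of n M] assms even_odd zero by simp
    next
      case one
      then show ?thesis using y1 HWP_two_one assms(2) by simp
    next
      case two
      then show ?thesis using HWP_two_two[OF assms(2)] even_odd by simp
    next
      case ee
      then show ?thesis using HWP_near_even[OF assms(2) even_odd(2) ee(1) m0 ee(2,3)] assms(3) m by simp
    next
      case eo
      then show ?thesis using HWP_twisted_odd_M_odd_y[OF assms(2) even_odd(2) eo(1) m0 eo(2,3)] assms(3) m by simp
    next
      case oo
      then show ?thesis using HWP_near_odd[OF assms(2) even_odd(2) oo] assms(3) m by simp
    next
      case oe
      have "y \<noteq> 2" using assms(5) oe mod m even_odd by auto
      then have "4 \<le> y" using oe by presburger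
      then show ?thesis using HWP_twisted_odd_M_even_y[OF assms(2) even_odd(2) oe(1-3)] assms(3) m by simp
    qed
  qed
qed

end
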